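(* Let $\tau>g^2+\Delta$. Then for $\operatorname{Re}(s)>1$, \[ \zeta_{\mathrm{QRM}}(s;\tau)=-\frac{\Gamma(1-s)}{2\pi i}\int_{\infty}^{(0+)}\frac{(-w)^{s-1}\Omega(w)e^{-\tau w}}{1-e^{-w}}\,dw, \] where the contour starts at $+\infty$ on the real axis, encircles the origin once in the positive direction along a circle of radius $\rho$ with $0<\rho<r$, and returns to $+\infty$, and $|\arg(-w)|\le\pi$. The right-hand side gives a meromorphic continuation of $\zeta_{\mathrm{QRM}}(s;\tau)$ to all $s\in\mathbb{C}$, whose only singularity is a simple pole at $s=1$ with residue $2$.
   Context: $H_{\mathrm{Rabi}}=a^\dagger a+\Delta\sigma_z+g(a+a^\dagger)\sigma_x$ on $L^2(\mathbb{R})\otimes\mathbb{C}^2$ ($g,\Delta>0$) has discrete spectrum $\lambda_1\le\lambda_2\le\cdots\to\infty$ (with multiplicity), with $\lambda_j\ge -g^2-\Delta$. The spectral zeta function is $\zeta_{\mathrm{QRM}}(s;\tau)=\sum_{j\ge1}(\lambda_j+\tau)^{-s}$, absolutely convergent for $\operatorname{Re}s>1$. The partition function is $Z_{\mathrm{Rabi}}(t)=\operatorname{Tr}e^{-tH_{\mathrm{Rabi}}}=\sum_j e^{-t\lambda_j}$ ($t>0$), and $\Omega(t):=(1-e^{-t})Z_{\mathrm{Rabi}}(t)$. It is known that $\Omega$ extends to a holomorphic function on the union of the half-plane $\operatorname{Re}t>0$ and a disc $|t|<r$ for some $0<r<\pi$; $\Omega$ denotes this extension. *)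

theory Defs
  imports "HOL-Analysis.Analysis" "HOL-Library.Function_Algebras" "HOL-Library.Product_Plus"
    "HOL-Complex_Analysis.Complex_Analysis"
begin

text \<open>State space L2(R) (x) C2 realised in the Fock (Hermite) basis: a state is a pair (u, v)
  of square-summable sequences; u n is the coefficient of |n> (x) e_up (sigma_z = +1),
  v n that of |n> (x) e_down (sigma_z = -1).\<close>

definition l2seq :: "(nat \<Rightarrow> complex) \<Rightarrow> bool" where
  "l2seq u \<longleftrightarrow> summable (\<lambda>n. (cmod (u n))^2)"

text \<open>Action of H = a^+ a + Delta sigma_z + g (a + a^+) sigma_x on coefficient sequences,
  with a |n> = sqrt n |n-1>, a^+ |n> = sqrt (n+1) |n+1>.\<close>

definition rabi_apply ::
  "real \<Rightarrow> real \<Rightarrow> (nat \<Rightarrow> complex) \<times> (nat \<Rightarrow> complex) \<Rightarrow> (nat \<Rightarrow> complex) \<times> (nat \<Rightarrow> complex)" where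
  "rabi_apply g \<Delta> \<psi> =
    ((\<lambda>n. of_nat n * fst \<psi> n + of_real \<Delta> * fst \<psi> n
          + of_real g * (of_real (sqrt (real n + 1)) * snd \<psi> (Suc n) + of_real (sqrt (real n)) * snd \<psi> (n - 1))),
     (\<lambda>n. of_nat n * snd \<psi> n - of_real \<Delta> * snd \<psi> n
          + of_real g * (of_real (sqrt (real n + 1)) * fst \<psi> (Suc n) + of_real (sqrt (real n)) * fst \<psi> (n - 1))))"

definition state_scale :: "complex \<Rightarrow> (nat \<Rightarrow> complex) \<times> (nat \<Rightarrow> complex) \<Rightarrow> (nat \<Rightarrow> complex) \<times> (nat \<Rightarrow> complex)" where
  "state_scale c \<psi> = ((\<lambda>n. c * fst \<psi> n), (\<lambda>n. c * snd \<psi> n))"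

text \<open>Eigenspace of H_Rabi for the value E (H is the self-adjoint = maximal operator).\<close>
definition rabi_eigenspace :: "real \<Rightarrow> real \<Rightarrow> real \<Rightarrow> ((nat \<Rightarrow> complex) \<times> (nat \<Rightarrow> complex)) set" where
  "rabi_eigenspace g \<Delta> E = {\<psi>. l2seq (fst \<psi>) \<and> l2seq (snd \<psi>) \<and>
       rabi_apply g \<Delta> \<psi> = state_scale (of_real E) \<psi>}"

definition rabi_spectrum :: "real \<Rightarrow> real \<Rightarrow> real set" where
  "rabi_spectrum g \<Delta> = {E. rabi_eigenspace g \<Delta> E \<noteq> {0}}"

definition rabi_mult :: "real \<Rightarrow> real \<Rightarrow> real \<Rightarrow> nat" where
  "rabi_mult g \<Delta> E = vector_space.dim state_scale (rabi_eigenspace g \<Delta> E)"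

definition Z_Rabi :: "real \<Rightarrow> real \<Rightarrow> real \<Rightarrow> real" where
  "Z_Rabi g \<Delta> t = (\<Sum>\<^sub>\<infinity>E\<in>rabi_spectrum g \<Delta>. of_nat (rabi_mult g \<Delta> E) * exp (- t * E))"

definition zeta_QRM :: "real \<Rightarrow> real \<Rightarrow> complex \<Rightarrow> real \<Rightarrow> complex" where
  "zeta_QRM g \<Delta> s \<tau> = (\<Sum>\<^sub>\<infinity>E\<in>rabi_spectrum g \<Delta>.
       of_nat (rabi_mult g \<Delta> E) * (of_real (E + \<tau>)) powr (- s))"

definition hankel_F :: "(complex \<Rightarrow> complex) \<Rightarrow> real \<Rightarrow> complex \<Rightarrow> complex" where
  "hankel_F Om \<tau> w = Om w * exp (- of_real \<tau> * w) / (1 - exp (- w))"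

text \<open>Incoming ray (from +infinity to rho): arg(-w) = -pi; outgoing ray: arg(-w) = pi.\<close>
definition hankel_in :: "(complex \<Rightarrow> complex) \<Rightarrow> real \<Rightarrow> complex \<Rightarrow> real \<Rightarrow> complex" where
  "hankel_in Om \<tau> s x = exp ((s - 1) * (Ln (of_real x) - \<i> * of_real pi)) * hankel_F Om \<tau> (of_real x)"

definition hankel_out :: "(complex \<Rightarrow> complex) \<Rightarrow> real \<Rightarrow> complex \<Rightarrow> real \<Rightarrow> complex" where
  "hankel_out Om \<tau> s x = exp ((s - 1) * (Ln (of_real x) + \<i> * of_real pi)) * hankel_F Om \<tau> (of_real x)"

text \<open>Hankel contour integral: from +infinity to rho, the positively oriented circle |w| = rho
  (starting and ending at rho; principal branch of (-w)^(s-1), which has |arg(-w)| < pi on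
  the circle except at the endpoint), then from rho back to +infinity.\<close>
definition hankel_integral :: "(complex \<Rightarrow> complex) \<Rightarrow> real \<Rightarrow> real \<Rightarrow> complex \<Rightarrow> complex" where
  "hankel_integral Om \<tau> \<rho> s =
     - integral {\<rho>..} (hankel_in Om \<tau> s)
     + contour_integral (circlepath 0 \<rho>) (\<lambda>w. (- w) powr (s - 1) * hankel_F Om \<tau> w)
     + integral {\<rho>..} (hankel_out Om \<tau> s)"

definition hankel_rhs :: "(complex \<Rightarrow> complex) \<Rightarrow> real \<Rightarrow> real \<Rightarrow> complex \<Rightarrow> complex" where
  "hankel_rhs Om \<tau> \<rho> s = - Gamma (1 - s) / (2 * of_real pi * \<i>) * hankel_integral Om \<tau> \<rho> s"

end

theory Submission
  imports Defs "HOL-Real_Asymp.Real_Asymp"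
begin

text \<open>
  Conservation of parity splits the Hamiltonian into two Jacobi operators with off-diagonal entries
  \<open>g * sqrt (n + 1)\<close> and diagonal entries \<open>n + (-1) ^ n * d\<close>, where \<open>d = \<Delta>\<close> or \<open>d = - \<Delta>\<close>. Since the
  diagonal eventually dominates, a solution of the three-term recurrence either decays geometrically
  (and \<open>E\<close> is an eigenvalue) or grows, and a discrete Sturm oscillation argument shows that the number
  of eigenvalues below \<open>E\<close> is the number of sign changes of the solution at \<open>E\<close>. Counting sign changes
  directly gives \<open>\<lambda> k = k + o(k)\<close> for the \<open>k\<close>-th eigenvalue of either operator, so \<open>t * Z t\<close> tends
  to 2 for \<open>t\<close> tending to 0, that is, \<open>\<Omega> 0 = 2\<close>.

  The Mellin transform of \<open>exp (- \<tau> * t) * Z t\<close> is \<open>Gamma s * \<zeta> s\<close> for \<open>Re s > 1\<close>; there the Hankel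
  contour collapses onto the positive axis and picks up the factor \<open>- 2 * \<i> * sin (pi * s)\<close>, which
  the reflection formula cancels. The contour integral is entire in \<open>s\<close>, so poles can only come from
  \<open>Gamma (1 - s)\<close>, and those at \<open>s = 2, 3, \<dots>\<close> are excluded by the equality with \<open>\<zeta>\<close>. At \<open>s = 1\<close>
  the two rays cancel and the circle contributes \<open>2 * pi * \<i> * \<Omega> 0\<close>.
\<close>

section \<open>Sturm oscillation for Jacobi operators\<close>

text \<open>The hypotheses tie \<open>Om\<close> to the trace only on the positive axis and leave
  \<open>Om 0\<close> open, although the residue is exactly this value; hence the need for an
  eigenvalue asymptotics. It must be drawn from eigenspaces given by a recurrence with a summability
  condition, and counting sign changes uses nothing but continuity in \<open>E\<close> and
  identities for finite sections. Accuracy to first order,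
  \<open>(1 - e) * k - C \<le> ev k \<le> (1 + e) * k + C\<close> for every small \<open>e\<close>,
  is enough, because \<open>C\<close> is invisible as \<open>t\<close> tends to 0. Two obstacles
  shape the oscillation argument: zeros of the solution at interior indices, and the jump of the
  count at an eigenvalue, where the new sign change enters from infinity and is seen by no fixed
  finite section. On the contour side the radius is never shrunk; an explicit primitive on the
  segment and on the circle replaces a deformation along the cut.\<close>

lemma same_sign: "(x::real) * y > 0 \<Longrightarrow> y * z > 0 \<Longrightarrow> x * z > 0"
  by (auto simp: zero_less_mult_iff)

lemma finite_set_rank:
  fixes T :: "real set"
  assumes "finite T" "k < card T"
  shows "\<exists>x\<in>T. card (T \<inter> {..<x}) = k"
  using assms
proof (induction T rule: finite_linorder_max_induct)
  case (insert x T)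
  have x: "x \<notin> T" using insert by auto
  show ?case
  proof (cases "k = card T")
    case True
    have "insert x T \<inter> {..<x} = T" using insert by auto
    thus ?thesis using True by auto
  next
    case False
    hence "k < card T" using insert x by simp
    then obtain y where y: "y \<in> T" "card (T \<inter> {..<y}) = k" using insert by auto
    have "insert x T \<inter> {..<y} = T \<inter> {..<y}" using insert y by auto
    thus ?thesis using y by (intro bexI[of _ y]) auto
  qed
qed simp

text \<open>Off-diagonal entries enter with reversed sign: up to the factor \<open>(-1) ^ n\<close>
  restored in \<open>chain_sol\<close>, this is the formal eigenvector of the matrix with entries
  \<open>a\<close> and \<open>b\<close>. With this sign the solution is positive below the spectrum,
  so that sign changes count eigenvalues.\<close>

fun jacobi_sol :: "(nat \<Rightarrow> real) \<Rightarrow> (nat \<Rightarrow> real) \<Rightarrow> real \<Rightarrow> nat \<Rightarrow> real" where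
  "jacobi_sol a b E 0 = 1"
| "jacobi_sol a b E (Suc 0) = (b 0 - E) / a 0"
| "jacobi_sol a b E (Suc (Suc n)) =
     ((b (Suc n) - E) * jacobi_sol a b E (Suc n) - a n * jacobi_sol a b E n) / a (Suc n)"

text \<open>\<open>dominant\<close> asks for one \<open>a n\<close> more than diagonal dominance:
  the slack makes growth strict and turns decay into halving. \<open>a_le\<close> lets geometric
  decay beat the factor \<open>a n\<close> of the Wronskian. \<open>positive\<close> anchors the
  count, which is 0 up to \<open>c\<close>.\<close>

locale jacobi =
  fixes a b :: "nat \<Rightarrow> real" and c A :: real
  assumes a_pos: "\<And>n. a n > 0"
    and a_le: "\<And>n. a n \<le> A * (real n + 1)"
    and dominant: "\<And>E. \<exists>N. \<forall>n\<ge>N. b (Suc n) - E \<ge> a (Suc n) + 2 * a n"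
    and positive: "\<And>E n. E \<le> c \<Longrightarrow> jacobi_sol a b E n > 0"
begin

abbreviation Q :: "real \<Rightarrow> nat \<Rightarrow> real" where "Q \<equiv> jacobi_sol a b"

text \<open>Convergence to 0 stands in for square-summability: once the diagonal dominates, a
  solution either grows in modulus or at least halves at each step, so the two agree
  (\<open>l2seq_chain_sol_iff\<close>).\<close>

definition point_spectrum :: "real set" where "point_spectrum = {E. Q E \<longlonglongrightarrow> 0}"

definition dominant_from :: "real \<Rightarrow> nat \<Rightarrow> bool" where
  "dominant_from E N \<longleftrightarrow> (\<forall>n\<ge>N. b (Suc n) - E \<ge> a (Suc n) + 2 * a n)"

text \<open>A zero is counted only in the pair it opens: its two neighbours have opposite signs, so a passage
  through zero is counted exactly once.\<close>
definition flip :: "real \<Rightarrow> nat \<Rightarrow> bool" where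
  "flip E n \<longleftrightarrow> Q E n * Q E (Suc n) < 0 \<or> Q E n = 0"

definition flips :: "real \<Rightarrow> nat" where "flips E = card {n. flip E n}"

definition flips_upto :: "real \<Rightarrow> nat \<Rightarrow> nat" where "flips_upto E N = card {n. n < N \<and> flip E n}"

lemma a_neq [simp]: "a n \<noteq> 0"
  using a_pos[of n] by simp

lemma Q_rec: "a (Suc n) * Q E (Suc (Suc n)) = (b (Suc n) - E) * Q E (Suc n) - a n * Q E n"
  by simp

declare jacobi_sol.simps(3) [simp del]

lemma Q_no_double_zero: "Q E n \<noteq> 0 \<or> Q E (Suc n) \<noteq> 0"
proof (induction n)
  case (Suc n)
  then show ?case using Q_rec[of n E] by auto
qed simp

lemma Q_across_zero:
  assumes "Q E (Suc n) = 0"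
  shows "Q E n * Q E (Suc (Suc n)) < 0"
proof -
  have *: "a (Suc n) * Q E (Suc (Suc n)) = - a n * Q E n"
    using Q_rec[of n E] assms by simp
  have "Q E n \<noteq> 0" using Q_no_double_zero[of E n] assms by auto
  have "a (Suc n) * (Q E n * Q E (Suc (Suc n))) = Q E n * (a (Suc n) * Q E (Suc (Suc n)))"
    by simp
  also have "\<dots> = - (a n * (Q E n)\<^sup>2)"
    unfolding * by (simp add: power2_eq_square)
  also have "\<dots> < 0" using a_pos[of n] \<open>Q E n \<noteq> 0\<close> by simp
  finally show ?thesis using a_pos[of "Suc n"] by (simp add: mult_less_0_iff)
qed

lemma continuous_Q: "continuous_on UNIV (\<lambda>E. Q E n)"
proof (induction n rule: induct_nat_012)
  case (ge2 n)
  then show ?case unfolding jacobi_sol.simps(3) by (intro continuous_intros) auto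
qed (auto intro!: continuous_intros)

lemma tendsto_Q: "((\<lambda>E. Q E n) \<longlongrightarrow> Q E0 n) (at E0)"
  using continuous_Q[of n] by (simp add: continuous_on_def)

section \<open>Growth or geometric decay where the diagonal dominates\<close>

lemma dominant_from_mono:
  "dominant_from E N \<Longrightarrow> E' \<le> E \<Longrightarrow> N \<le> N' \<Longrightarrow> dominant_from E' N'"
  unfolding dominant_from_def by (meson diff_left_mono order_trans)

lemma ex_dominant_from: "\<exists>N. dominant_from E N"
  using dominant unfolding dominant_from_def by blast

text \<open>Multiply the recurrence by \<open>Q E (Suc n)\<close>: the diagonal term outweighs the
  one with \<open>Q E n\<close> and leaves
  \<open>Q E (Suc n) * Q E (Suc (Suc n)) > (Q E (Suc n))\<^sup>2\<close>, which contains both the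
  growth and the equality of signs.\<close>

lemma growth_step:
  assumes "dominant_from E N" "n \<ge> N" "\<bar>Q E n\<bar> \<le> \<bar>Q E (Suc n)\<bar>"
  shows "\<bar>Q E (Suc n)\<bar> < \<bar>Q E (Suc (Suc n))\<bar> \<and> Q E (Suc n) * Q E (Suc (Suc n)) > 0"
proof -
  define x where "x = Q E (Suc n)"
  define y where "y = Q E (Suc (Suc n))"
  define d where "d = b (Suc n) - E"
  have d: "d \<ge> a (Suc n) + 2 * a n"
    using assms by (auto simp: dominant_from_def d_def)
  have x0: "x \<noteq> 0"
    using Q_no_double_zero[of E n] assms(3) by (auto simp: x_def)
  have rec: "a (Suc n) * y = d * x - a n * Q E n"
    using Q_rec[of n E] by (simp add: x_def y_def d_def)
  have "a n * (Q E n * x) \<le> a n * (\<bar>x\<bar> * \<bar>x\<bar>)"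
  proof (intro mult_left_mono)
    have "Q E n * x \<le> \<bar>Q E n\<bar> * \<bar>x\<bar>" by (metis abs_ge_self abs_mult)
    also have "\<dots> \<le> \<bar>x\<bar> * \<bar>x\<bar>" using assms(3) by (intro mult_right_mono) (auto simp: x_def)
    finally show "Q E n * x \<le> \<bar>x\<bar> * \<bar>x\<bar>" .
  qed (use a_pos[of n] in auto)
  moreover have "d * x\<^sup>2 \<ge> (a (Suc n) + 2 * a n) * x\<^sup>2"
    using d by (intro mult_right_mono) auto
  moreover have "a (Suc n) * (x * y) = d * x\<^sup>2 - a n * (Q E n * x)"
    using arg_cong[OF rec, of "\<lambda>z. x * z"] by (simp add: algebra_simps power2_eq_square)
  moreover have "a n * x\<^sup>2 > 0" using a_pos[of n] x0 by simp
  ultimately have *: "a (Suc n) * (x * y) > a (Suc n) * x\<^sup>2"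
    by (simp add: algebra_simps power2_eq_square)
  hence **: "x * y > x\<^sup>2"
    using a_pos[of "Suc n"] by simp
  hence pos: "x * y > 0"
    using zero_le_power2[of x] by linarith
  have "\<bar>x\<bar> * \<bar>x\<bar> < \<bar>x\<bar> * \<bar>y\<bar>"
    using ** pos by (simp add: power2_eq_square flip: abs_mult)
  hence "\<bar>x\<bar> < \<bar>y\<bar>" by (simp only: mult_less_cancel_left split: if_splits)
  with pos show ?thesis by (simp add: x_def y_def)
qed

lemma growth:
  assumes "dominant_from E N" "n \<ge> N" "\<bar>Q E n\<bar> \<le> \<bar>Q E (Suc n)\<bar>" "m > n"
  shows "\<bar>Q E m\<bar> < \<bar>Q E (Suc m)\<bar> \<and> Q E m * Q E (Suc m) > 0"
proof -
  have "Suc n \<le> m" using assms by simp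
  thus ?thesis
  proof (induction m rule: dec_induct)
    case base
    show ?case using growth_step[OF assms(1-3)] .
  next
    case (step m)
    show ?case using growth_step[OF assms(1), of m] step assms(2) by auto
  qed
qed

lemma growth_no_flip:
  assumes "dominant_from E N" "n \<ge> N" "\<bar>Q E n\<bar> \<le> \<bar>Q E (Suc n)\<bar>" "m > n"
  shows "\<not> flip E m"
  using growth[OF assms] by (auto simp: flip_def)

lemma growth_not_in_spectrum:
  assumes "dominant_from E N" "n \<ge> N" "\<bar>Q E n\<bar> \<le> \<bar>Q E (Suc n)\<bar>"
  shows "E \<notin> point_spectrum"
proof
  assume "E \<in> point_spectrum"
  hence lim: "(\<lambda>m. \<bar>Q E m\<bar>) \<longlonglongrightarrow> 0" by (simp add: point_spectrum_def tendsto_rabs_zero)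
  have "\<bar>Q E (Suc n)\<bar> \<le> \<bar>Q E m\<bar>" if "m \<ge> Suc n" for m
    using that
  proof (induction m rule: dec_induct)
    case (step m)
    show ?case using growth[OF assms, of m] step by auto
  qed simp
  hence "\<bar>Q E (Suc n)\<bar> \<le> 0"
    by (intro tendsto_lowerbound[OF lim]) (auto simp: eventually_at_top_linorder)
  thus False using growth[OF assms, of "Suc n"] by auto
qed

text \<open>The estimate of \<open>growth_step\<close> with the recurrence solved backwards for
  \<open>Q E n\<close>; it turns mere decrease into decrease by half.\<close>

lemma decay_step:
  assumes "dominant_from E N" "n \<ge> N" "\<bar>Q E (Suc (Suc n))\<bar> < \<bar>Q E (Suc n)\<bar>"
  shows "2 * \<bar>Q E (Suc n)\<bar> \<le> \<bar>Q E n\<bar> \<and> Q E n * Q E (Suc n) > 0"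
proof -
  define x where "x = Q E (Suc n)"
  define y where "y = Q E (Suc (Suc n))"
  define d where "d = b (Suc n) - E"
  have d: "d \<ge> a (Suc n) + 2 * a n"
    using assms by (auto simp: dominant_from_def d_def)
  have x0: "x \<noteq> 0"
    using assms(3) by (auto simp: x_def)
  have rec: "a n * Q E n = d * x - a (Suc n) * y"
    using Q_rec[of n E] by (simp add: x_def y_def d_def)
  have "a (Suc n) * (y * x) \<le> a (Suc n) * (\<bar>x\<bar> * \<bar>x\<bar>)"
  proof (intro mult_left_mono)
    have "y * x \<le> \<bar>y\<bar> * \<bar>x\<bar>" by (metis abs_ge_self abs_mult)
    also have "\<dots> \<le> \<bar>x\<bar> * \<bar>x\<bar>" using assms(3) by (intro mult_right_mono) (auto simp: x_def y_def)
    finally show "y * x \<le> \<bar>x\<bar> * \<bar>x\<bar>" .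
  qed (use a_pos[of "Suc n"] in auto)
  moreover have "d * x\<^sup>2 \<ge> (a (Suc n) + 2 * a n) * x\<^sup>2"
    using d by (intro mult_right_mono) auto
  moreover have "a n * (Q E n * x) = d * x\<^sup>2 - a (Suc n) * (y * x)"
    using arg_cong[OF rec, of "\<lambda>z. x * z"] by (simp add: algebra_simps power2_eq_square)
  ultimately have *: "a n * (Q E n * x) \<ge> a n * (2 * x\<^sup>2)"
    by (simp add: algebra_simps power2_eq_square)
  hence **: "Q E n * x \<ge> 2 * x\<^sup>2"
    using a_pos[of n] by simp
  moreover have "x\<^sup>2 > 0" using x0 by simp
  ultimately have pos: "Q E n * x > 0" by linarith
  have "2 * \<bar>x\<bar> * \<bar>x\<bar> \<le> \<bar>Q E n\<bar> * \<bar>x\<bar>"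
    using ** pos by (simp add: power2_eq_square flip: abs_mult)
  hence "2 * \<bar>x\<bar> \<le> \<bar>Q E n\<bar>" using x0 by simp
  with pos show ?thesis by (simp add: x_def)
qed

lemma decay_bound:
  assumes "\<And>n. n \<ge> N \<Longrightarrow> 2 * \<bar>Q E (Suc n)\<bar> \<le> \<bar>Q E n\<bar>"
  shows "\<exists>C. \<forall>n. \<bar>Q E n\<bar> \<le> C / 2 ^ n"
proof -
  \<comment> \<open>The weights \<open>2 ^ i\<close> make the constant cover the terms up to
    \<open>N\<close>, where nothing is known about decay.\<close>
  define C where "C = (\<Sum>i\<le>N. \<bar>Q E i\<bar> * 2 ^ i)"
  have small: "\<bar>Q E n\<bar> \<le> C / 2 ^ n" if "n \<le> N" for n
  proof -
    have "\<bar>Q E n\<bar> * 2 ^ n \<le> C" unfolding C_def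
      by (rule member_le_sum) (use that in auto)
    thus ?thesis by (simp add: field_simps)
  qed
  have "\<bar>Q E n\<bar> \<le> C / 2 ^ n" for n
  proof (cases "n \<le> N")
    case False
    hence "N \<le> n" by simp
    thus ?thesis
    proof (induction n rule: dec_induct)
      case base show ?case using small by simp
    next
      case (step n)
      have "2 * \<bar>Q E (Suc n)\<bar> \<le> C / 2 ^ n" using assms[of n] step by simp
      thus ?case by (simp add: field_simps)
    qed
  qed (use small in auto)
  thus ?thesis by blast
qed

lemma spectrum_decay:
  assumes "dominant_from E N" "E \<in> point_spectrum" "n \<ge> N"
  shows "2 * \<bar>Q E (Suc n)\<bar> \<le> \<bar>Q E n\<bar> \<and> Q E n * Q E (Suc n) > 0"
proof -
  have "\<bar>Q E (Suc (Suc n))\<bar> < \<bar>Q E (Suc n)\<bar>"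
    using growth_not_in_spectrum[OF assms(1), of "Suc n"] assms by fastforce
  thus ?thesis using decay_step[OF assms(1), of n] assms by simp
qed

lemma spectrum_geometric:
  assumes "E \<in> point_spectrum"
  shows "\<exists>C. \<forall>n. \<bar>Q E n\<bar> \<le> C / 2 ^ n"
proof -
  obtain N where N: "dominant_from E N" using ex_dominant_from by blast
  have "2 * \<bar>Q E (Suc n)\<bar> \<le> \<bar>Q E n\<bar>" if "n \<ge> N" for n
    using spectrum_decay[OF N assms that] by simp
  thus ?thesis by (rule decay_bound)
qed

lemma decay_in_spectrum:
  assumes "dominant_from E N" "\<And>n. n \<ge> N \<Longrightarrow> \<bar>Q E (Suc n)\<bar> < \<bar>Q E n\<bar>"
  shows "E \<in> point_spectrum"
proof -
  have "2 * \<bar>Q E (Suc n)\<bar> \<le> \<bar>Q E n\<bar>" if "n \<ge> N" for n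
    using decay_step[OF assms(1), of n] assms(2)[of "Suc n"] that by auto
  then obtain C where C: "\<And>n. \<bar>Q E n\<bar> \<le> C / 2 ^ n" using decay_bound by blast
  have lim: "(\<lambda>n. C / 2 ^ n) \<longlonglongrightarrow> 0" by real_asymp
  have "Q E \<longlonglongrightarrow> 0"
    by (rule Lim_null_comparison[OF _ lim]) (use C in auto)
  thus ?thesis by (simp add: point_spectrum_def)
qed

lemma not_spectrum_growth:
  assumes "dominant_from E N" "E \<notin> point_spectrum"
  shows "\<exists>n\<ge>N. \<bar>Q E n\<bar> \<le> \<bar>Q E (Suc n)\<bar>"
  using decay_in_spectrum[OF assms(1)] assms(2) by (meson not_le)

section \<open>Wronskian of the solutions at two energies\<close>

definition wronskian :: "real \<Rightarrow> real \<Rightarrow> nat \<Rightarrow> real" where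
  "wronskian E E' n = a n * (Q E (Suc n) * Q E' n - Q E n * Q E' (Suc n))"

lemma wronskian_Suc:
  "wronskian E E' (Suc n) = wronskian E E' n + (E' - E) * (Q E (Suc n) * Q E' (Suc n))"
proof -
  have "wronskian E E' (Suc n) = (a (Suc n) * Q E (Suc (Suc n))) * Q E' (Suc n)
          - Q E (Suc n) * (a (Suc n) * Q E' (Suc (Suc n)))"
    by (simp add: wronskian_def algebra_simps)
  also have "\<dots> = wronskian E E' n + (E' - E) * (Q E (Suc n) * Q E' (Suc n))"
    unfolding Q_rec by (simp add: wronskian_def algebra_simps)
  finally show ?thesis .
qed

text \<open>Christoffel-Darboux formula: the increments of \<open>wronskian_Suc\<close> telescope,
  and the entry at 0 already has the same form.\<close>

lemma wronskian_eq_sum: "wronskian E E' n = (E' - E) * (\<Sum>i\<le>n. Q E i * Q E' i)"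
proof (induction n)
  case 0
  show ?case by (simp add: wronskian_def field_simps)
next
  case (Suc n)
  show ?case by (simp only: wronskian_Suc Suc sum.atMost_Suc distrib_left)
qed

lemma wronskian_mono:
  assumes "E \<le> E'" "\<And>i. N \<le> i \<Longrightarrow> i \<le> n \<Longrightarrow> Q E i * Q E' i \<ge> 0" "N \<le> n"
  shows "wronskian E E' N \<le> wronskian E E' n"
  using assms(3,2)
proof (induction n rule: dec_induct)
  case (step n)
  have "0 \<le> (E' - E) * (Q E (Suc n) * Q E' (Suc n))"
    by (rule mult_nonneg_nonneg) (use assms(1) step.prems[of "Suc n"] step.hyps in auto)
  thus ?case using step by (simp add: wronskian_Suc)
qed simp

lemma wronskian_spectrum_tendsto_0:
  assumes "E \<in> point_spectrum" "E' \<in> point_spectrum"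
  shows "wronskian E E' \<longlonglongrightarrow> 0"
proof -
  obtain C where C: "\<And>n. \<bar>Q E n\<bar> \<le> C / 2 ^ n" using spectrum_geometric[OF assms(1)] by blast
  obtain D where D: "\<And>n. \<bar>Q E' n\<bar> \<le> D / 2 ^ n" using spectrum_geometric[OF assms(2)] by blast
  have lim: "(\<lambda>n. A * (real n + 1) * (2 * ((C / 2 ^ n) * (D / 2 ^ n)))) \<longlonglongrightarrow> 0"
    by real_asymp
  have C0: "C \<ge> 0" using C[of 0] by simp
  have D0: "D \<ge> 0" using D[of 0] by simp
  have "norm (wronskian E E' n) \<le> A * (real n + 1) * (2 * ((C / 2 ^ n) * (D / 2 ^ n)))" for n
  proof -
    have C': "\<bar>Q E (Suc n)\<bar> \<le> C / 2 ^ n"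
      by (rule order_trans[OF C[of "Suc n"]]) (use C0 in \<open>simp add: field_simps\<close>)
    have D': "\<bar>Q E' (Suc n)\<bar> \<le> D / 2 ^ n"
      by (rule order_trans[OF D[of "Suc n"]]) (use D0 in \<open>simp add: field_simps\<close>)
    have "\<bar>Q E (Suc n) * Q E' n\<bar> \<le> C / 2 ^ n * (D / 2 ^ n)"
      unfolding abs_mult using C' D[of n] by (intro mult_mono) auto
    moreover have "\<bar>Q E n * Q E' (Suc n)\<bar> \<le> C / 2 ^ n * (D / 2 ^ n)"
      unfolding abs_mult using C[of n] D' by (intro mult_mono) auto
    ultimately have "\<bar>Q E (Suc n) * Q E' n - Q E n * Q E' (Suc n)\<bar> \<le> 2 * (C / 2 ^ n * (D / 2 ^ n))"
      by linarith
    thus ?thesis unfolding wronskian_def norm_mult using a_pos[of n] a_le[of n]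
      by (intro mult_mono) auto
  qed
  thus ?thesis by (intro Lim_null_comparison[OF _ lim] always_eventually) auto
qed

section \<open>Sign changes as a function of the energy\<close>

lemma flips_upto_Suc: "flips_upto E (Suc N) = flips_upto E N + (if flip E N then 1 else 0)"
proof -
  have "{n. n < Suc N \<and> flip E n} = (if flip E N then insert N {n. n < N \<and> flip E n}
          else {n. n < N \<and> flip E n})"
    by (auto simp: less_Suc_eq)
  thus ?thesis by (simp add: flips_upto_def)
qed

lemma eventually_Q_sgn:
  assumes "Q E0 n \<noteq> 0"
  shows "eventually (\<lambda>E. sgn (Q E n) = sgn (Q E0 n)) (at E0)"
proof (cases "Q E0 n > 0")
  case True
  show ?thesis using order_tendstoD(1)[OF tendsto_Q True]
    by eventually_elim (use True in auto)
next
  case False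
  hence *: "Q E0 n < 0" using assms by auto
  show ?thesis using order_tendstoD(2)[OF tendsto_Q *]
    by eventually_elim (use * in auto)
qed

lemma flip_iff_sgn: "flip E n \<longleftrightarrow> sgn (Q E n) * sgn (Q E (Suc n)) < 0 \<or> sgn (Q E n) = 0"
  by (auto simp: flip_def sgn_if mult_less_0_iff)

text \<open>Signs are stable near \<open>E0\<close> except at zeros of \<open>Q E0\<close>. Such a
  zero has neighbours of opposite sign, and then exactly one of the two adjacent pairs is a flip,
  whatever the value in the middle; hence an induction that can jump over it in two steps.\<close>

lemma eventually_flips_upto:
  assumes "Q E0 N \<noteq> 0"
  shows "eventually (\<lambda>E. flips_upto E N = flips_upto E0 N) (at E0)"
  using assms
proof (induction N rule: induct_nat_012)
  case 0
  show ?case by (simp add: flips_upto_def)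
next
  case 1
  have "\<not> flip E 0 \<longleftrightarrow> sgn (Q E (Suc 0)) \<ge> 0" for E
    by (auto simp: flip_def sgn_if)
  hence *: "flip E 0 \<longleftrightarrow> sgn (Q E (Suc 0)) < 0" for E by (meson not_le)
  show ?case using eventually_Q_sgn[OF 1]
    by eventually_elim (simp add: flips_upto_Suc[of _ 0] flips_upto_def[of _ 0] * del: jacobi_sol.simps)
next
  case (ge2 n)
  show ?case
  proof (cases "Q E0 (Suc n) = 0")
    case False
    show ?thesis
      using ge2(2)[OF False] eventually_Q_sgn[OF False] eventually_Q_sgn[OF ge2(3)]
      by eventually_elim (simp add: flips_upto_Suc[of _ "Suc n"] flip_iff_sgn)
  next
    case True
    have n0: "Q E0 n \<noteq> 0" using Q_no_double_zero[of E0 n] True by auto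
    have opp: "Q E0 n * Q E0 (Suc (Suc n)) < 0" using Q_across_zero[OF True] .
    have one: "flips_upto E (Suc (Suc n)) = flips_upto E n + 1"
      if "Q E n * Q E (Suc (Suc n)) < 0" for E
    proof -
      have "(flip E n \<and> \<not> flip E (Suc n)) \<or> (\<not> flip E n \<and> flip E (Suc n))"
        using that by (auto simp: flip_def mult_less_0_iff)
      thus ?thesis by (auto simp: flips_upto_Suc)
    qed
    have "((\<lambda>E. Q E n * Q E (Suc (Suc n))) \<longlongrightarrow> Q E0 n * Q E0 (Suc (Suc n))) (at E0)"
      by (intro tendsto_intros tendsto_Q)
    from order_tendstoD(2)[OF this opp] ge2(1)[OF n0] show ?thesis
      by eventually_elim (simp add: one opp)
  qed
qed

lemma flips_eq_flips_upto:
  assumes "\<And>m. m \<ge> N \<Longrightarrow> \<not> flip E m"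
  shows "flips E = flips_upto E N"
proof -
  have "{n. flip E n} = {n. n < N \<and> flip E n}" using assms by (auto simp: not_le[symmetric])
  thus ?thesis by (simp add: flips_def flips_upto_def)
qed

lemma flips_eq_flips_upto_plus_one:
  assumes "\<And>m. m \<ge> N \<Longrightarrow> flip E m \<longleftrightarrow> m = k" "k \<ge> N"
  shows "flips E = flips_upto E N + 1"
proof -
  have "{n. flip E n} = insert k {n. n < N \<and> flip E n}" using assms by (auto simp: not_le[symmetric])
  moreover have "k \<notin> {n. n < N \<and> flip E n}" using assms by auto
  ultimately show ?thesis by (simp add: flips_def flips_upto_def)
qed

text \<open>If the sign changes, both summands of the recurrence push in the same direction and the
  modulus cannot shrink any more. So a flip in the dominant range starts the growth that excludes
  further flips and membership in the spectrum. \<open>k\<close> is \<open>Suc n\<close> if that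
  term is zero, and \<open>n\<close> otherwise.\<close>

lemma single_flip:
  assumes "dominant_from E N" "n \<ge> N" "Q E n \<noteq> 0" "Q E n * Q E (Suc n) \<le> 0"
  obtains k where "k \<ge> n" "\<And>m. m \<ge> n \<Longrightarrow> flip E m \<longleftrightarrow> m = k" "E \<notin> point_spectrum"
proof -
  define x where "x = Q E (Suc n)"
  define y where "y = Q E (Suc (Suc n))"
  define d where "d = b (Suc n) - E"
  have d: "d \<ge> a (Suc n) + 2 * a n"
    using assms by (auto simp: dominant_from_def d_def)
  have rec: "a (Suc n) * y = d * x - a n * Q E n"
    using Q_rec[of n E] by (simp add: x_def y_def d_def)
  have grow: "\<bar>x\<bar> \<le> \<bar>y\<bar> \<and> (x \<noteq> 0 \<longrightarrow> x * y > 0)"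
  proof (cases "x = 0")
    case False
    have "a (Suc n) * (x * y) = d * x\<^sup>2 - a n * (Q E n * x)"
      using arg_cong[OF rec, of "\<lambda>z. x * z"] by (simp add: algebra_simps power2_eq_square)
    moreover have "a n * (Q E n * x) \<le> 0" using assms(4) a_pos[of n] by (simp add: x_def mult_le_0_iff)
    moreover have "d * x\<^sup>2 \<ge> a (Suc n) * x\<^sup>2"
      using d a_pos[of n] by (intro mult_right_mono) auto
    ultimately have "a (Suc n) * (x * y) \<ge> a (Suc n) * x\<^sup>2" by linarith
    hence *: "x * y \<ge> x\<^sup>2" using a_pos[of "Suc n"] by simp
    have "x\<^sup>2 > 0" using False by simp
    with * have pos: "x * y > 0" by linarith
    have "\<bar>x\<bar> * \<bar>x\<bar> \<le> \<bar>x\<bar> * \<bar>y\<bar>"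
      using * pos by (simp add: power2_eq_square flip: abs_mult)
    hence "\<bar>x\<bar> \<le> \<bar>y\<bar>" by (simp only: mult_le_cancel_left) (use False in auto)
    thus ?thesis using pos by simp
  qed simp
  have nf: "\<not> flip E m" if "m \<ge> Suc (Suc n)" for m
    using growth_no_flip[OF assms(1), of "Suc n" m] grow that assms(2) by (simp add: x_def y_def)
  have ns: "E \<notin> point_spectrum"
    using growth_not_in_spectrum[OF assms(1), of "Suc n"] grow assms(2) by (simp add: x_def y_def)
  have cases: "m = n \<or> m = Suc n \<or> m \<ge> Suc (Suc n)" if "m \<ge> n" for m using that by linarith
  show ?thesis
  proof (cases "x = 0")
    case True
    have "flip E m \<longleftrightarrow> m = Suc n" if "m \<ge> n" for m
      using cases[OF that] nf[of m] True assms(3) by (auto simp: flip_def x_def)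
    thus ?thesis using that[of "Suc n"] ns by simp
  next
    case False
    have "Q E n * x < 0" using assms(3,4) False by (auto simp: x_def mult_le_0_iff mult_less_0_iff)
    moreover have "x * y > 0" using grow False by auto
    ultimately have "flip E m \<longleftrightarrow> m = n" if "m \<ge> n" for m
      using cases[OF that] nf[of m] False by (auto simp: flip_def x_def y_def)
    thus ?thesis using that[of n] ns by simp
  qed
qed

text \<open>Off the spectrum growth sets in at some index. This is an open condition on
  \<open>E\<close>, so for all nearby \<open>E\<close> the flips lie in one fixed finite
  section.\<close>

lemma flips_locally_constant:
  assumes "E0 \<notin> point_spectrum"
  shows "eventually (\<lambda>E. flips E = flips E0 \<and> E \<notin> point_spectrum) (at E0)"
proof -
  \<comment> \<open>Dominance at \<open>E0 + 1\<close> provides one \<open>N\<close> for all smaller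
    \<open>E\<close>, in particular for all \<open>E\<close> near \<open>E0\<close>.\<close>
  obtain N where N: "dominant_from (E0 + 1) N" using ex_dominant_from by blast
  have N0: "dominant_from E0 N" using dominant_from_mono[OF N] by simp
  obtain n0 where n0: "n0 \<ge> N" "\<bar>Q E0 n0\<bar> \<le> \<bar>Q E0 (Suc n0)\<bar>"
    using not_spectrum_growth[OF N0 assms] by blast
  define n where "n = Suc n0"
  have n: "n \<ge> N" "\<bar>Q E0 n\<bar> < \<bar>Q E0 (Suc n)\<bar>"
    using growth_step[OF N0 n0] n0 by (auto simp: n_def)
  have nz: "Q E0 (Suc n) \<noteq> 0" using n(2) by auto
  have "((\<lambda>E. \<bar>Q E (Suc n)\<bar> - \<bar>Q E n\<bar>) \<longlongrightarrow> \<bar>Q E0 (Suc n)\<bar> - \<bar>Q E0 n\<bar>) (at E0)"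
    by (intro tendsto_intros tendsto_Q)
  from order_tendstoD(1)[OF this, of 0] n(2)
  have ev1: "eventually (\<lambda>E. \<bar>Q E n\<bar> < \<bar>Q E (Suc n)\<bar>) (at E0)" by simp
  have ev2: "eventually (\<lambda>E. E < E0 + 1) (at E0)"
    by (rule order_tendstoD(2)[OF tendsto_ident_at]) auto
  have E0: "flips E0 = flips_upto E0 (Suc n)"
    by (rule flips_eq_flips_upto) (use growth_no_flip[OF N0 n(1)] n(2) in auto)
  show ?thesis using ev1 ev2 eventually_flips_upto[OF nz]
  proof eventually_elim
    case (elim E)
    have D: "dominant_from E N" using dominant_from_mono[OF N] elim by simp
    have "flips E = flips_upto E (Suc n)"
      by (rule flips_eq_flips_upto) (use growth_no_flip[OF D n(1)] elim in auto)
    thus ?case using elim E0 growth_not_in_spectrum[OF D n(1)] by simp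
  qed
qed

text \<open>Follow the ratio of \<open>Q E\<close> to the decaying \<open>Q E0\<close> from
  \<open>N\<close> on. While it is positive, the Wronskian does not decrease in modulus, so the
  ratio keeps rising for \<open>E < E0\<close> and never changes sign. For \<open>E > E0\<close> it
  keeps falling; if it stayed positive, \<open>Q E\<close> would decay as well, and the Wronskian of
  two spectral points would tend to 0, against its lower bound. The first departure from positivity
  is then the only new flip.\<close>

lemma flips_jump:
  assumes "E0 \<in> point_spectrum"
  shows "eventually (\<lambda>E. flips E = flips E0 + (if E > E0 then 1 else 0) \<and> E \<notin> point_spectrum) (at E0)"
proof -
  obtain N where N: "dominant_from (E0 + 1) N" using ex_dominant_from by blast
  have N0: "dominant_from E0 N" using dominant_from_mono[OF N] by simp
  have dec: "2 * \<bar>Q E0 (Suc n)\<bar> \<le> \<bar>Q E0 n\<bar>" "Q E0 n * Q E0 (Suc n) > 0" if "n \<ge> N" for n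
    using spectrum_decay[OF N0 assms that] by auto
  have nz: "Q E0 n \<noteq> 0" if "n \<ge> N" for n using dec(2)[OF that] by auto
  have E0: "flips E0 = flips_upto E0 N"
    by (rule flips_eq_flips_upto) (use dec(2) in \<open>fastforce simp: flip_def\<close>)
  \<comment> \<open>The Wronskian itself vanishes at \<open>E = E0\<close>. Its cofactor of
    \<open>E0 - E\<close> becomes a sum of squares there, at least 1 because
    \<open>Q E0 0 = 1\<close>, and this settles the sign of the Wronskian on both sides at
    once.\<close>
  have "((\<lambda>E. \<Sum>i\<le>N. Q E i * Q E0 i) \<longlongrightarrow> (\<Sum>i\<le>N. Q E0 i * Q E0 i)) (at E0)"
    by (intro tendsto_intros tendsto_Q)
  moreover have "(\<Sum>i\<le>N. Q E0 i * Q E0 i) \<ge> Q E0 0 * Q E0 0"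
    by (rule member_le_sum) auto
  hence "(\<Sum>i\<le>N. Q E0 i * Q E0 i) > 0" by simp
  ultimately have ev1: "eventually (\<lambda>E. (\<Sum>i\<le>N. Q E i * Q E0 i) > 0) (at E0)"
    by (rule order_tendstoD)
  have ev2: "eventually (\<lambda>E. E < E0 + 1) (at E0)"
    by (rule order_tendstoD(2)[OF tendsto_ident_at]) auto
  have ev3: "eventually (\<lambda>E. E \<noteq> E0) (at E0)" by (simp add: eventually_at_filter)
  show ?thesis
    using ev1 ev2 ev3 eventually_flips_upto[OF nz[OF order_refl]] eventually_Q_sgn[OF nz[OF order_refl]]
  proof eventually_elim
    case (elim E)
    have D: "dominant_from E N" using dominant_from_mono[OF N] elim by simp
    have posN: "Q E N * Q E0 N > 0"
      using elim(5) nz[of N] by (auto simp: sgn_if zero_less_mult_iff split: if_splits)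
    have noflip: "\<not> flip E m" if "Q E m * Q E0 m > 0" "Q E (Suc m) * Q E0 (Suc m) > 0" "m \<ge> N" for m
      using that dec(2)[OF that(3)] by (auto simp: flip_def zero_less_mult_iff mult_less_0_iff)
    show ?case
    proof (cases "E < E0")
      case True
      have W: "wronskian E E0 N > 0" using elim(1) True by (simp add: wronskian_eq_sum)
      have pos: "\<forall>i. N \<le> i \<longrightarrow> i \<le> n \<longrightarrow> Q E i * Q E0 i > 0" if "n \<ge> N" for n
        using that
      proof (induction n rule: dec_induct)
        case base
        show ?case using posN by auto
      next
        case (step n)
        have "wronskian E E0 N \<le> wronskian E E0 n"
          by (rule wronskian_mono) (use True step in \<open>auto intro: less_imp_le\<close>)
        hence "wronskian E E0 n > 0" using W by simp
        hence "Q E (Suc n) * Q E0 n > Q E n * Q E0 (Suc n)"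
          using a_pos[of n] by (simp add: wronskian_def zero_less_mult_iff)
        moreover have "Q E n * Q E0 n > 0" using step by auto
        ultimately have "Q E (Suc n) * Q E0 n > 0"
          using same_sign[OF _ dec(2)[OF step.hyps(1)], of "Q E n"] by linarith
        hence "Q E (Suc n) * Q E0 (Suc n) > 0"
          using same_sign[OF _ dec(2)[OF step.hyps(1)]] by blast
        thus ?case using step by (auto simp: le_Suc_eq)
      qed
      have E: "flips E = flips_upto E N"
      proof (rule flips_eq_flips_upto)
        fix m assume "m \<ge> N"
        thus "\<not> flip E m" using noflip[of m] pos[of m] pos[of "Suc m"] by simp
      qed
      have "E \<notin> point_spectrum"
      proof
        assume "E \<in> point_spectrum"
        hence "wronskian E E0 \<longlonglongrightarrow> 0" using wronskian_spectrum_tendsto_0 assms by blast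
        moreover have "wronskian E E0 N \<le> wronskian E E0 n" if "n \<ge> N" for n
          by (rule wronskian_mono) (use True that pos in \<open>auto intro: less_imp_le\<close>)
        hence "eventually (\<lambda>n. wronskian E E0 N \<le> wronskian E E0 n) sequentially"
          by (auto simp: eventually_at_top_linorder)
        ultimately have "wronskian E E0 N \<le> 0"
          by (rule tendsto_lowerbound) auto
        thus False using W by simp
      qed
      thus ?thesis using E E0 elim True by simp
    next
      case False
      hence gt: "E > E0" using elim by simp
      have W: "wronskian E0 E N > 0" using elim(1) gt by (simp add: wronskian_eq_sum mult.commute)
      have "\<exists>n\<ge>N. \<not> Q E n * Q E0 n > 0"
      proof (rule ccontr)
        assume "\<not> ?thesis"
        hence pos: "Q E n * Q E0 n > 0" if "n \<ge> N" for n using that by auto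
        have Wn: "wronskian E0 E N \<le> wronskian E0 E n" if "n \<ge> N" for n
          by (rule wronskian_mono) (use gt that pos in \<open>auto intro: less_imp_le simp: mult.commute\<close>)
        have "\<bar>Q E (Suc n)\<bar> < \<bar>Q E n\<bar>" if n: "n \<ge> N" for n
        proof -
          have "wronskian E0 E n > 0" using Wn[OF n] W by simp
          hence *: "Q E0 n * Q E (Suc n) < Q E0 (Suc n) * Q E n"
            using a_pos[of n] by (simp add: wronskian_def zero_less_mult_iff)
          have p1: "Q E0 (Suc n) * Q E n > 0" "Q E0 n * Q E (Suc n) > 0"
            using pos[of n] pos[of "Suc n"] dec(2)[OF n] n by (auto simp: zero_less_mult_iff)
          have "\<bar>Q E0 n\<bar> * \<bar>Q E (Suc n)\<bar> < \<bar>Q E0 (Suc n)\<bar> * \<bar>Q E n\<bar>"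
            using * p1 by (simp flip: abs_mult)
          also have "\<dots> \<le> \<bar>Q E0 n\<bar> * \<bar>Q E n\<bar>"
            by (rule mult_right_mono) (use dec(1)[OF n] in auto)
          finally show ?thesis using nz[OF n] by simp
        qed
        hence "E \<in> point_spectrum" by (rule decay_in_spectrum[OF D])
        hence "wronskian E0 E \<longlonglongrightarrow> 0" using wronskian_spectrum_tendsto_0 assms by blast
        hence "wronskian E0 E N \<le> 0"
          by (rule tendsto_lowerbound) (use Wn in \<open>auto simp: eventually_at_top_linorder\<close>)
        thus False using W by simp
      qed
      define n where "n = (LEAST n. n \<ge> N \<and> \<not> Q E n * Q E0 n > 0)"
      have n: "n \<ge> N" "\<not> Q E n * Q E0 n > 0"
        unfolding n_def using LeastI_ex[OF \<open>\<exists>n\<ge>N. \<not> Q E n * Q E0 n > 0\<close>[unfolded Bex_def]] by auto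
      have before: "Q E m * Q E0 m > 0" if "N \<le> m" "m < n" for m
        using not_less_Least[of m "\<lambda>n. n \<ge> N \<and> \<not> Q E n * Q E0 n > 0"] that by (auto simp: n_def)
      have "n \<noteq> N" using n posN by auto
      then obtain m where m: "n = Suc m" "m \<ge> N" using n(1) by (cases n) auto
      have pm: "Q E m * Q E0 m > 0" using before m by auto
      have "Q E m * Q E (Suc m) \<le> 0"
        using n(2) pm dec(2)[OF m(2)] unfolding m
        by (auto simp: zero_less_mult_iff mult_le_0_iff not_less)
      moreover have "Q E m \<noteq> 0" using pm by auto
      ultimately obtain k where k: "k \<ge> m" "\<And>j. j \<ge> m \<Longrightarrow> flip E j \<longleftrightarrow> j = k" "E \<notin> point_spectrum"
        using single_flip[OF D m(2)] by metis
      have "flip E j \<longleftrightarrow> j = k" if j: "j \<ge> N" for j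
      proof (cases "j \<ge> m")
        case False
        hence "\<not> flip E j" using noflip[OF _ _ j] before[of j] before[of "Suc j"] m j by auto
        thus ?thesis using False k(1) by auto
      qed (use k in auto)
      hence "flips E = flips_upto E N + 1"
        by (rule flips_eq_flips_upto_plus_one) (use k m in auto)
      thus ?thesis using k(3) E0 elim gt by simp
    qed
  qed
qed

section \<open>Counting eigenvalues by sign changes\<close>

lemma flips_0:
  assumes "E \<le> c"
  shows "flips E = 0"
proof -
  have "\<not> flip E n" for n
    using positive[OF assms, of n] mult_pos_pos[OF positive[OF assms, of n] positive[OF assms, of "Suc n"]]
    by (simp add: flip_def)
  thus ?thesis by (simp add: flips_def)
qed

text \<open>Just above an eigenvalue the count is positive by \<open>flips_jump\<close>, whereas it
  is 0 up to \<open>c\<close>.\<close>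

lemma spectrum_ge:
  assumes "E \<in> point_spectrum"
  shows "c \<le> E"
proof (rule ccontr)
  assume "\<not> c \<le> E"
  hence "E < c" by simp
  have "eventually (\<lambda>E'. flips E' = flips E + (if E' > E then 1 else 0)) (at_right E)"
    using flips_jump[OF assms] by (auto elim: eventually_mono simp: eventually_at_split)
  moreover have "eventually (\<lambda>E'. E' \<in> {E<..<c}) (at_right E)"
    using \<open>E < c\<close> by (rule eventually_at_right_real)
  ultimately have "eventually (\<lambda>E'. False) (at_right E)"
    by eventually_elim (use flips_0 \<open>E < c\<close> in force)
  thus False by simp
qed

lemma finite_spectrum_below: "finite (point_spectrum \<inter> {..<E})"
proof (rule ccontr)
  assume inf: "infinite (point_spectrum \<inter> {..<E})"
  have sub: "point_spectrum \<inter> {..<E} \<subseteq> {c..E}" using spectrum_ge by auto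
  obtain x where "x islimpt (point_spectrum \<inter> {..<E})"
    using Heine_Borel_imp_Bolzano_Weierstrass[OF _ inf sub] by auto
  hence "x islimpt point_spectrum" by (rule islimpt_subset) auto
  moreover have "eventually (\<lambda>y. y \<notin> point_spectrum) (at x)"
    using flips_jump[of x] flips_locally_constant[of x]
    by (cases "x \<in> point_spectrum") (auto elim: eventually_mono)
  ultimately show False
    by (simp add: islimpt_iff_eventually)
qed

text \<open>Both counts are constant off the spectrum and jump by one immediately after each
  eigenvalue. Their difference is therefore locally constant on the connected real line, and it
  vanishes at \<open>c\<close>.\<close>

theorem card_spectrum_below: "card (point_spectrum \<inter> {..<E}) = flips E"
proof -
  define S where "S = point_spectrum"
  define h where "h E = int (flips E) - int (card (S \<inter> {..<E}))" for E
  have loc: "eventually (\<lambda>y. h x = h y) (at x)" for x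
  proof -
    have "eventually (\<lambda>y. y \<notin> S) (at x)"
      using flips_jump[of x] flips_locally_constant[of x]
      by (cases "x \<in> S") (auto elim: eventually_mono simp: S_def)
    then obtain d where d: "d > 0" "\<And>y. y \<noteq> x \<Longrightarrow> \<bar>y - x\<bar> < d \<Longrightarrow> y \<notin> S"
      unfolding eventually_at by (auto simp: dist_real_def)
    have ev: "eventually (\<lambda>y. \<bar>y - x\<bar> < d \<and> y \<noteq> x) (at x)"
      unfolding eventually_at using d(1) by (auto simp: dist_real_def)
    have card: "card (S \<inter> {..<y}) = card (S \<inter> {..<x}) + (if x \<in> S \<and> y > x then 1 else 0)"
      if y: "\<bar>y - x\<bar> < d" for y
    proof (cases "x \<in> S \<and> y > x")
      case True
      have "S \<inter> {..<y} = insert x (S \<inter> {..<x})"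
      proof (rule set_eqI)
        fix z show "z \<in> S \<inter> {..<y} \<longleftrightarrow> z \<in> insert x (S \<inter> {..<x})"
          using True d(2)[of z] y by (smt (verit) Int_iff lessThan_iff insert_iff)
      qed
      thus ?thesis using True finite_spectrum_below[of x] by (simp add: S_def)
    next
      case False
      have *: "z \<in> S \<inter> {..<y} \<longleftrightarrow> z \<in> S \<inter> {..<x}" for z
        using False d(2)[of z] y by (smt (verit) Int_iff lessThan_iff)
      have "S \<inter> {..<y} = S \<inter> {..<x}" by (rule set_eqI) (rule *)
      thus ?thesis using False by simp
    qed
    show ?thesis
    proof (cases "x \<in> S")
      case True
      from flips_jump[OF True[unfolded S_def]] ev show ?thesis
        by eventually_elim (use True card in \<open>auto simp: h_def\<close>)
    next
      case False
      from flips_locally_constant[OF False[unfolded S_def]] ev show ?thesis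
        by eventually_elim (use False card in \<open>auto simp: h_def\<close>)
    qed
  qed
  have "h E = h c"
    by (rule connected_local_const[of UNIV]) (use loc in auto)
  moreover have "S \<inter> {..<c} = {}" using spectrum_ge by (force simp: S_def)
  ultimately show ?thesis using flips_0[of c] by (simp add: h_def S_def)
qed

section \<open>Two-sided bounds on the number of sign changes\<close>

lemma flips_le:
  assumes "dominant_from E N"
  shows "flips E \<le> N + 1"
proof -
  \<comment> \<open>From \<open>N\<close> on at most one flip can occur, since the solution grows
    after it.\<close>
  have "card {n. flip E n \<and> n \<ge> N} \<le> 1 \<and> finite {n. flip E n \<and> n \<ge> N}"
  proof (cases "\<exists>n\<ge>N. flip E n")
    case True
    define n where "n = (LEAST n. n \<ge> N \<and> flip E n)"
    have n: "n \<ge> N" "flip E n"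
      using LeastI_ex[OF True[unfolded Bex_def]] by (auto simp: n_def)
    have least: "m \<ge> n" if "m \<ge> N" "flip E m" for m
      unfolding n_def using that by (intro Least_le) auto
    have after: "\<not> flip E m" if "m > n" for m
    proof (cases "Q E n = 0")
      case True
      show ?thesis using growth_no_flip[OF assms n(1) _ that] True by simp
    next
      case False
      then obtain k where "k \<ge> n" "\<And>m. m \<ge> n \<Longrightarrow> flip E m \<longleftrightarrow> m = k"
        using single_flip[OF assms n(1)] n(2) by (metis flip_def less_imp_le)
      thus ?thesis using n(2) that by auto
    qed
    have "{n. flip E n \<and> n \<ge> N} \<subseteq> {n}"
    proof
      fix m assume "m \<in> {n. flip E n \<and> n \<ge> N}"
      thus "m \<in> {n}" using least[of m] after[of m] by (cases "m > n") auto
    qed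
    hence "{n. flip E n \<and> n \<ge> N} = {n}" using n by auto
    thus ?thesis by simp
  next
    case False
    hence *: "{n. flip E n \<and> n \<ge> N} = {}" by auto
    show ?thesis unfolding * by simp
  qed
  moreover have "{n. flip E n} \<subseteq> {..<N} \<union> {n. flip E n \<and> n \<ge> N}" by auto
  ultimately have "flips E \<le> card ({..<N} \<union> {n. flip E n \<and> n \<ge> N})"
    unfolding flips_def by (intro card_mono) auto
  also have "\<dots> \<le> N + 1" using card_Un_le[of "{..<N}" "{n. flip E n \<and> n \<ge> N}"]
    \<open>card {n. flip E n \<and> n \<ge> N} \<le> 1 \<and> finite {n. flip E n \<and> n \<ge> N}\<close> by simp
  finally show ?thesis .
qed

lemma finite_flips: "finite {n. flip E n}"
proof -
  obtain N where N: "dominant_from E N" using ex_dominant_from by blast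
  show ?thesis
  proof (cases "\<exists>n\<ge>N. \<bar>Q E n\<bar> \<le> \<bar>Q E (Suc n)\<bar>")
    case True
    then obtain n where "n \<ge> N" "\<bar>Q E n\<bar> \<le> \<bar>Q E (Suc n)\<bar>" by blast
    hence "{n. flip E n} \<subseteq> {..n}" using growth_no_flip[OF N] by (auto simp: not_less[symmetric])
    thus ?thesis using finite_subset by blast
  next
    case False
    hence "E \<in> point_spectrum" using not_spectrum_growth[OF N] by blast
    hence "\<not> flip E n" if "n \<ge> N" for n
      using spectrum_decay[OF N _ that] by (auto simp: flip_def)
    hence "{n. flip E n} \<subseteq> {..N}" by (metis (mono_tags) atMost_iff mem_Collect_eq nat_le_linear subsetI)
    thus ?thesis using finite_subset by blast
  qed
qed

text \<open>The regime opposite to \<open>dominant_from\<close>: \<open>E\<close> exceeds the first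
  \<open>m\<close> diagonal entries by a Gershgorin margin. Each step then reverses the sign without
  shrinking the modulus, and the preserved modulus is what carries the induction.\<close>

lemma flips_ge:
  assumes "m > 0 \<Longrightarrow> E \<ge> b 0 + a 0" "\<And>n. Suc n < m \<Longrightarrow> E \<ge> b (Suc n) + a (Suc n) + a n"
  shows "flips E \<ge> m"
proof -
  have *: "Q E n * Q E (Suc n) < 0 \<and> \<bar>Q E n\<bar> \<le> \<bar>Q E (Suc n)\<bar>" if "n < m" for n
    using that
  proof (induction n)
    case 0
    have "(b 0 - E) / a 0 \<le> -1" using assms(1) 0 a_pos[of 0] by (simp add: field_simps)
    hence "Q E (Suc 0) \<le> -1" by simp
    thus ?case by (simp del: jacobi_sol.simps(2))
  next
    case (Suc n)
    define x where "x = Q E (Suc n)"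
    define y where "y = Q E (Suc (Suc n))"
    define d where "d = E - b (Suc n)"
    have d: "d \<ge> a (Suc n) + a n" using assms(2)[OF Suc.prems] by (simp add: d_def)
    have IH: "Q E n * x < 0" "\<bar>Q E n\<bar> \<le> \<bar>x\<bar>" using Suc by (auto simp: x_def)
    have x0: "x \<noteq> 0" using IH by auto
    have rec: "a (Suc n) * y = - d * x - a n * Q E n"
      using Q_rec[of n E] by (simp add: x_def y_def d_def algebra_simps)
    have "a (Suc n) * (x * y) = - d * x\<^sup>2 + a n * (- (Q E n * x))"
      using arg_cong[OF rec, of "\<lambda>z. x * z"] by (simp add: algebra_simps power2_eq_square)
    moreover have "a n * (- (Q E n * x)) \<le> a n * x\<^sup>2"
    proof (rule mult_left_mono)
      have "- (Q E n * x) \<le> \<bar>Q E n\<bar> * \<bar>x\<bar>" by (simp flip: abs_mult)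
      also have "\<dots> \<le> \<bar>x\<bar> * \<bar>x\<bar>" by (rule mult_right_mono) (use IH in auto)
      finally show "- (Q E n * x) \<le> x\<^sup>2" by (simp add: power2_eq_square)
    qed (use a_pos[of n] in auto)
    moreover have "d * x\<^sup>2 \<ge> (a (Suc n) + a n) * x\<^sup>2"
      using d by (intro mult_right_mono) auto
    ultimately have "a (Suc n) * (x * y) \<le> a (Suc n) * (- x\<^sup>2)" by (simp add: algebra_simps)
    hence 1: "x * y \<le> - x\<^sup>2" using a_pos[of "Suc n"] by (simp only: mult_le_cancel_left_pos)
    have "x\<^sup>2 > 0" using x0 by simp
    hence 2: "x * y < 0" using 1 by linarith
    have "\<bar>x\<bar> * \<bar>x\<bar> \<le> \<bar>x\<bar> * \<bar>y\<bar>"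
      using 1 2 by (simp add: power2_eq_square flip: abs_mult)
    hence "\<bar>x\<bar> \<le> \<bar>y\<bar>" by (simp only: mult_le_cancel_left) (use x0 in auto)
    thus ?case using 2 by (simp add: x_def y_def)
  qed
  hence "{..<m} \<subseteq> {n. flip E n}" by (auto simp: flip_def)
  from card_mono[OF finite_flips this] show ?thesis by (simp add: flips_def)
qed

section \<open>Eigenvalues indexed by their number of sign changes\<close>

lemma flips_mono: "E \<le> E' \<Longrightarrow> flips E \<le> flips E'"
  unfolding card_spectrum_below[symmetric] by (intro card_mono finite_spectrum_below) auto

lemma flips_strict_mono:
  assumes "E \<in> point_spectrum" "E < E'"
  shows "flips E < flips E'"
proof -
  have "point_spectrum \<inter> {..<E} \<subset> point_spectrum \<inter> {..<E'}" using assms by auto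
  thus ?thesis unfolding card_spectrum_below[symmetric]
    by (intro psubset_card_mono finite_spectrum_below)
qed

text \<open>On the spectrum \<open>flips\<close> is the rank of an eigenvalue, hence injective
  there; every rank is attained because the count is unbounded.\<close>

lemma bij_betw_flips:
  assumes "\<And>m. \<exists>E. flips E \<ge> m"
  shows "bij_betw flips point_spectrum UNIV"
proof -
  have "inj_on flips point_spectrum"
    using flips_strict_mono by (intro linorder_inj_onI) fastforce+
  moreover have "k \<in> flips ` point_spectrum" for k
  proof -
    obtain E where "flips E \<ge> Suc k" using assms by blast
    hence "k < card (point_spectrum \<inter> {..<E})" by (simp add: card_spectrum_below)
    from finite_set_rank[OF finite_spectrum_below this] obtain x where
      x: "x \<in> point_spectrum" "x < E" "card (point_spectrum \<inter> {..<E} \<inter> {..<x}) = k" by auto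
    have "point_spectrum \<inter> {..<E} \<inter> {..<x} = point_spectrum \<inter> {..<x}" using x(2) by auto
    thus ?thesis using x by (auto simp: card_spectrum_below)
  qed
  ultimately show ?thesis by (auto simp: bij_betw_def)
qed

end

section \<open>Eigenvalue asymptotics in a parity sector\<close>

definition rabi_offdiag :: "real \<Rightarrow> nat \<Rightarrow> real" where
  "rabi_offdiag g n = g * sqrt (real n + 1)"

definition rabi_diag :: "real \<Rightarrow> nat \<Rightarrow> real" where
  "rabi_diag d n = real n + (-1) ^ n * d"

lemma rabi_diag_bounds: "real n - \<bar>d\<bar> \<le> rabi_diag d n" "rabi_diag d n \<le> real n + \<bar>d\<bar>"
  by (cases "even n"; simp add: rabi_diag_def)+

lemma rabi_offdiag_le:
  assumes "g > 0" "m \<le> n"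
  shows "rabi_offdiag g m \<le> rabi_offdiag g n"
  using assms by (simp add: rabi_offdiag_def)

text \<open>Completing the square trades square-root growth for an arbitrarily small slope
  \<open>e\<close>. The factor 3 covers the combination \<open>a (Suc n) + 2 * a n\<close> of the
  dominance condition.\<close>

lemma rabi_offdiag_linear_bound:
  assumes "g > 0" "e > 0"
  shows "3 * rabi_offdiag g n \<le> e * real n + (e + 9 * g\<^sup>2 / (4 * e))"
proof -
  have "0 \<le> (sqrt e * sqrt (real n + 1) - 3 * g / (2 * sqrt e))\<^sup>2" by simp
  also have "\<dots> = e * (real n + 1) - 3 * (g * sqrt (real n + 1)) + 9 * g\<^sup>2 / (4 * e)"
    using assms by (simp add: power2_diff power_mult_distrib power_divide)
  finally show ?thesis by (simp add: rabi_offdiag_def algebra_simps)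
qed

text \<open>For \<open>E \<le> - g\<^sup>2 - \<bar>d\<bar>\<close> the solution dominates that of the displaced oscillator, whose ground
  state has the coefficients \<open>g ^ n / sqrt (fact n)\<close>.\<close>
lemma rabi_sol_positive:
  assumes "g > 0" "E \<le> - g\<^sup>2 - \<bar>d\<bar>"
  shows "jacobi_sol (rabi_offdiag g) (rabi_diag d) E n > 0"
proof -
  define Q where "Q = jacobi_sol (rabi_offdiag g) (rabi_diag d) E"
  \<comment> \<open>For the coefficients \<open>g ^ n / sqrt (fact n)\<close> the second conjunct is
    an equality, so the invariant compares the ratios of successive terms.\<close>
  have "Q n > 0 \<and> rabi_offdiag g n * Q (Suc n) \<ge> g\<^sup>2 * Q n"
  proof (induction n)
    case 0
    have "rabi_offdiag g 0 \<noteq> 0" using assms by (simp add: rabi_offdiag_def)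
    hence "rabi_offdiag g 0 * Q (Suc 0) = rabi_diag d 0 - E" by (simp add: Q_def)
    moreover have "rabi_diag d 0 - E \<ge> g\<^sup>2" using assms rabi_diag_bounds(1)[where n=0 and d=d] by simp
    ultimately show ?case by (simp add: Q_def)
  next
    case (Suc n)
    have pos: "rabi_offdiag g m > 0" for m using assms by (simp add: rabi_offdiag_def)
    have "g\<^sup>2 * Q n > 0" using Suc assms by simp
    hence Q1: "Q (Suc n) > 0" using Suc pos[of n] by (smt (verit) mult_nonneg_nonpos)
    have "rabi_offdiag g (Suc n) * Q (Suc (Suc n)) =
        (rabi_diag d (Suc n) - E) * Q (Suc n) - rabi_offdiag g n * Q n"
      using pos[of "Suc n"] by (simp add: Q_def)
    moreover have "rabi_offdiag g n * Q n \<le> (real n + 1) * Q (Suc n)"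
    proof -
      have "g\<^sup>2 * (rabi_offdiag g n * Q n) \<le> rabi_offdiag g n * (rabi_offdiag g n * Q (Suc n))"
        using mult_left_mono[OF conjunct2[OF Suc], of "rabi_offdiag g n"] pos[of n]
        by (simp add: mult_ac)
      also have "\<dots> = g\<^sup>2 * ((real n + 1) * Q (Suc n))"
        by (simp add: rabi_offdiag_def power2_eq_square)
      finally show ?thesis using assms by simp
    qed
    moreover have "(rabi_diag d (Suc n) - E) * Q (Suc n) \<ge> (real n + 1 + g\<^sup>2) * Q (Suc n)"
      using assms rabi_diag_bounds(1)[of "Suc n" d] Q1 by (intro mult_right_mono) auto
    ultimately show ?case using Q1 by (simp add: algebra_simps)
  qed
  thus ?thesis by (simp add: Q_def)
qed

lemma rabi_jacobi:
  assumes "g > 0"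
  shows "jacobi (rabi_offdiag g) (rabi_diag d) (- g\<^sup>2 - \<bar>d\<bar>) g"
proof
  fix E
  have lim: "filterlim (\<lambda>n. real n + 1 - 3 * (g * sqrt (real n + 2))) at_top sequentially"
    by real_asymp
  then obtain N where N: "\<And>n. n \<ge> N \<Longrightarrow> real n + 1 - 3 * (g * sqrt (real n + 2)) \<ge> E + \<bar>d\<bar>"
    unfolding filterlim_at_top eventually_at_top_linorder by blast
  show "\<exists>N. \<forall>n\<ge>N. rabi_offdiag g (Suc n) + 2 * rabi_offdiag g n \<le> rabi_diag d (Suc n) - E"
  proof (intro exI[of _ N] allI impI)
    fix n assume "n \<ge> N"
    from N[OF this] show "rabi_offdiag g (Suc n) + 2 * rabi_offdiag g n \<le> rabi_diag d (Suc n) - E"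
      using rabi_offdiag_le[OF assms, of n "Suc n"] rabi_diag_bounds(1)[of "Suc n" d]
      by (simp add: rabi_offdiag_def add_ac)
  qed
next
  fix n
  have "sqrt (real n + 1) \<le> real n + 1"
    by (rule real_le_lsqrt) (auto simp: power2_eq_square algebra_simps)
  thus "rabi_offdiag g n \<le> g * (real n + 1)" using assms by (simp add: rabi_offdiag_def)
qed (use assms rabi_sol_positive in \<open>auto simp: rabi_offdiag_def\<close>)

definition rabi_parity_spectrum :: "real \<Rightarrow> real \<Rightarrow> real set" where
  "rabi_parity_spectrum g d = {E. jacobi_sol (rabi_offdiag g) (rabi_diag d) E \<longlonglongrightarrow> 0}"

lemma rabi_parity_spectrum_ge:
  assumes "g > 0" "E \<in> rabi_parity_spectrum g d"
  shows "E \<ge> - g\<^sup>2 - \<bar>d\<bar>"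
proof -
  interpret jacobi "rabi_offdiag g" "rabi_diag d" "- g\<^sup>2 - \<bar>d\<bar>" g by (rule rabi_jacobi[OF assms(1)])
  show ?thesis using spectrum_ge assms(2) by (simp add: point_spectrum_def rabi_parity_spectrum_def)
qed

text \<open>The bounds on \<open>flips\<close> trap the eigenvalue of rank \<open>k\<close>: by
  \<open>flips_ge\<close> more than \<open>k\<close> eigenvalues lie below
  \<open>(1 + e) * k + B e\<close>, and by \<open>flips_le\<close> the \<open>k\<close> eigenvalues
  below \<open>ev k\<close> force \<open>ev k\<close> up to about
  \<open>(1 - e) * k\<close>.\<close>

lemma rabi_parity_spectrum_enum:
  assumes "g > 0"
  obtains ev :: "nat \<Rightarrow> real" where "bij_betw ev UNIV (rabi_parity_spectrum g d)"
    "\<And>e. 0 < e \<Longrightarrow> e < 1 \<Longrightarrow> \<exists>C. \<forall>k. (1 - e) * real k - C \<le> ev k \<and> ev k \<le> (1 + e) * real k + C"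
proof -
  interpret jacobi "rabi_offdiag g" "rabi_diag d" "- g\<^sup>2 - \<bar>d\<bar>" g by (rule rabi_jacobi[OF assms])
  have PS: "rabi_parity_spectrum g d = point_spectrum"
    by (simp add: point_spectrum_def rabi_parity_spectrum_def)
  define D where "D = \<bar>d\<bar>"
  define K where "K e = 9 * g\<^sup>2 / (4 * e)" for e
  have K: "K e \<ge> 0" if "e > 0" for e using that by (simp add: K_def)
  have linear_bound: "3 * rabi_offdiag g n \<le> e * real n + (e + K e)" if "e > 0" for n e
    using rabi_offdiag_linear_bound[OF assms that] by (simp add: K_def)
  \<comment> \<open>\<open>D\<close> bounds the alternating part of the diagonal and
    \<open>e + K e\<close> is the constant of \<open>linear_bound\<close>; there is room to spare,
    so that one value serves both directions.\<close>
  define B where "B e = 1 + D + 2 * (e + K e) + 2 * e" for e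
  have many: "flips ((1 + e) * real k + B e) \<ge> Suc k" if e: "e > 0" for e k
  proof (rule flips_ge)
    have "rabi_diag d 0 + rabi_offdiag g 0 \<le> B e"
      using rabi_diag_bounds(2)[of d 0] linear_bound[OF e, of 0] a_pos[of 0] e K[OF e]
      by (simp add: B_def D_def)
    also have "\<dots> \<le> (1 + e) * real k + B e" using e by simp
    finally show "rabi_diag d 0 + rabi_offdiag g 0 \<le> (1 + e) * real k + B e" .
  next
    fix n assume n: "Suc n < Suc k"
    have "rabi_diag d (Suc n) + rabi_offdiag g (Suc n) + rabi_offdiag g n
        \<le> real (Suc n) + D + 3 * rabi_offdiag g (Suc n)"
      using rabi_diag_bounds(2)[of d "Suc n"] rabi_offdiag_le[OF assms, of n "Suc n"] a_pos[of "Suc n"]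
      by (simp add: D_def)
    also have "\<dots> \<le> real (Suc n) + D + e * real (Suc n) + (e + K e)"
      using linear_bound[OF e, of "Suc n"] by simp
    also have "\<dots> \<le> (1 + e) * real (Suc n) + B e"
      using e K[OF e] by (simp add: B_def algebra_simps)
    also have "\<dots> \<le> (1 + e) * real k + B e"
      using e n by (intro add_right_mono mult_left_mono) auto
    finally show "rabi_diag d (Suc n) + rabi_offdiag g (Suc n) + rabi_offdiag g n \<le> (1 + e) * real k + B e" .
  qed
  have "\<exists>E. flips E \<ge> m" for m using many[of 1 m] by (auto intro: Suc_leD)
  hence bij: "bij_betw flips point_spectrum UNIV" by (rule bij_betw_flips)
  define ev where "ev = the_inv_into point_spectrum flips"
  have ev: "bij_betw ev UNIV point_spectrum" unfolding ev_def by (rule bij_betw_the_inv_into[OF bij])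
  have in_ps: "ev k \<in> point_spectrum" for k using ev by (auto simp: bij_betw_def)
  have fl: "flips (ev k) = k" for k
    unfolding ev_def using bij by (intro f_the_inv_into_f) (auto simp: bij_betw_def)
  have "\<exists>C. \<forall>k. (1 - e) * real k - C \<le> ev k \<and> ev k \<le> (1 + e) * real k + C"
    if e: "0 < e" "e < 1" for e
  proof -
    define C where "C = B e + g\<^sup>2 + 3"
    have "ev k \<le> (1 + e) * real k + C" for k
    proof -
      have "flips (ev k) < flips ((1 + e) * real k + B e)" using many[OF e(1), of k] fl[of k] by simp
      hence "ev k \<le> (1 + e) * real k + B e" using flips_mono by (meson not_le less_imp_le)
      thus ?thesis by (simp add: C_def add.assoc[symmetric] add_increasing2)
    qed
    moreover have "(1 - e) * real k - C \<le> ev k" for k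
    proof -
      have c: "ev k \<ge> - g\<^sup>2 - D" using spectrum_ge[OF in_ps[of k]] by (simp add: D_def)
      \<comment> \<open>From index \<open>x\<close> on, \<open>(1 - e) * n \<ge> ev k + B e\<close>,
        which is dominance at energy \<open>ev k\<close>. The summand \<open>g\<^sup>2\<close> keeps
        \<open>x\<close> nonnegative, so that \<open>nat\<close> does not truncate.\<close>
      define x where "x = (ev k + B e + g\<^sup>2) / (1 - e)"
      have x0: "x \<ge> 0" using c e K[OF e(1)] by (auto simp: x_def B_def)
      define N where "N = nat \<lceil>x\<rceil>"
      have N: "real N \<ge> x" "real N \<le> x + 1" using x0 by (auto simp: N_def)
      have "dominant_from (ev k) N" unfolding dominant_from_def
      proof (intro allI impI)
        fix n assume n: "n \<ge> N"
        have "rabi_offdiag g (Suc n) + 2 * rabi_offdiag g n \<le> 3 * rabi_offdiag g (Suc n)"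
          using rabi_offdiag_le[OF assms, of n "Suc n"] by simp
        also have "\<dots> \<le> e * real (Suc n) + (e + K e)"
          using linear_bound[OF e(1)] .
        also have "\<dots> \<le> real (Suc n) - D - ev k"
        proof -
          have "(1 - e) * x = ev k + B e + g\<^sup>2" using e by (simp add: x_def)
          moreover have "(1 - e) * x \<le> (1 - e) * real n" using n N e by (intro mult_left_mono) auto
          ultimately have "ev k + B e + g\<^sup>2 \<le> (1 - e) * real n" by linarith
          moreover have "K e \<ge> 0" using e by (intro K)
          moreover have "g\<^sup>2 \<ge> 0" by simp
          ultimately have "ev k + B e \<le> (1 - e) * real n" "K e \<ge> 0" by linarith+
          thus ?thesis using e by (simp add: B_def D_def algebra_simps)
        qed
        also have "\<dots> \<le> rabi_diag d (Suc n) - ev k"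
          using rabi_diag_bounds(1)[of "Suc n" d] by (simp add: D_def)
        finally show "rabi_offdiag g (Suc n) + 2 * rabi_offdiag g n \<le> rabi_diag d (Suc n) - ev k" .
      qed
      \<comment> \<open>The 2 collects the extra flip allowed by \<open>flips_le\<close> and the
        rounding of \<open>x\<close>.\<close>
      from flips_le[OF this] fl[of k] have "real k \<le> x + 2" using N by simp
      hence "(1 - e) * real k \<le> (1 - e) * (x + 2)" using e by (intro mult_left_mono) auto
      also have "\<dots> = (1 - e) * x + 2 * (1 - e)" by (simp add: algebra_simps)
      also have "(1 - e) * x = ev k + B e + g\<^sup>2" using e by (simp add: x_def)
      also have "ev k + B e + g\<^sup>2 + 2 * (1 - e) \<le> ev k + C" using e by (simp add: C_def)
      finally show ?thesis by simp
    qed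
    ultimately show ?thesis by blast
  qed
  thus ?thesis using that[of ev] ev unfolding PS by blast
qed

section \<open>Heat trace at small times\<close>

lemma exp_sum_geometric:
  assumes "t > (0::real)" "p > 0"
  shows "(\<lambda>k. exp (- t * (p * real k + c))) sums (exp (- t * c) / (1 - exp (- t * p)))"
proof -
  have "(\<lambda>k. exp (- t * c) * exp (- t * p) ^ k) sums (exp (- t * c) * (1 / (1 - exp (- t * p))))"
    using assms by (intro sums_mult geometric_sums) auto
  moreover have "exp (- t * c) * exp (- t * p) ^ k = exp (- t * (p * real k + c))" for k
    by (simp add: exp_of_nat_mult[symmetric] exp_add[symmetric] algebra_simps)
  ultimately show ?thesis by simp
qed

text \<open>Comparison with two geometric series: the shift by \<open>C\<close> contributes only a
  factor tending to 1, so \<open>t\<close> times the sum is asymptotically squeezed between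
  \<open>1 / (1 + e)\<close> and \<open>1 / (1 - e)\<close>, for every \<open>e\<close>.\<close>

lemma heat_trace_asymptotics:
  fixes ev :: "nat \<Rightarrow> real"
  assumes ev: "\<And>e. 0 < e \<Longrightarrow> e < 1 \<Longrightarrow> \<exists>C. \<forall>k. (1 - e) * real k - C \<le> ev k \<and> ev k \<le> (1 + e) * real k + C"
  shows "t > 0 \<Longrightarrow> summable (\<lambda>k. exp (- t * ev k))"
    and "((\<lambda>t. t * (\<Sum>k. exp (- t * ev k))) \<longlongrightarrow> 1) (at_right 0)"
proof -
  have bounds: "summable (\<lambda>k. exp (- t * ev k))"
    "(\<Sum>k. exp (- t * ev k)) \<le> exp (t * C) / (1 - exp (- t * (1 - e)))"
    "(\<Sum>k. exp (- t * ev k)) \<ge> exp (- t * C) / (1 - exp (- t * (1 + e)))"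
    if t: "t > 0" and e: "0 < e" "e < 1" and
      C: "\<forall>k. (1 - e) * real k - C \<le> ev k \<and> ev k \<le> (1 + e) * real k + C" for t e C
  proof -
    have up: "(\<lambda>k. exp (- t * ((1 - e) * real k + (- C)))) sums (exp (- t * (- C)) / (1 - exp (- t * (1 - e))))"
      using t e by (intro exp_sum_geometric) auto
    have lo: "(\<lambda>k. exp (- t * ((1 + e) * real k + C))) sums (exp (- t * C) / (1 - exp (- t * (1 + e))))"
      using t e by (intro exp_sum_geometric) auto
    have le: "exp (- t * ev k) \<le> exp (- t * ((1 - e) * real k + (- C)))" for k
      using C t by simp
    have ge: "exp (- t * ev k) \<ge> exp (- t * ((1 + e) * real k + C))" for k
      using C t by simp
    show sm: "summable (\<lambda>k. exp (- t * ev k))"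
      by (rule summable_comparison_test'[OF sums_summable[OF up]]) (use le in simp)
    show "(\<Sum>k. exp (- t * ev k)) \<le> exp (t * C) / (1 - exp (- t * (1 - e)))"
      using sums_le[OF le summable_sums[OF sm] up] by simp
    show "(\<Sum>k. exp (- t * ev k)) \<ge> exp (- t * C) / (1 - exp (- t * (1 + e)))"
      using sums_le[OF ge lo summable_sums[OF sm]] by simp
  qed
  show "summable (\<lambda>k. exp (- t * ev k))" if "t > 0"
    using bounds(1)[OF that, of "1/2"] ev[of "1/2"] by auto
  show "((\<lambda>t. t * (\<Sum>k. exp (- t * ev k))) \<longlongrightarrow> 1) (at_right 0)"
  proof (rule order_tendstoI)
    fix y :: real assume y: "y < 1"
    have "((\<lambda>e::real. 1 / (1 + e)) \<longlongrightarrow> 1) (at_right 0)" by real_asymp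
    from order_tendstoD(1)[OF this y] eventually_at_right_real[of 0 "1::real"]
    have "eventually (\<lambda>e. y < 1 / (1 + e) \<and> e \<in> {0<..<1}) (at_right (0::real))"
      by (auto intro: eventually_conj)
    from eventually_happens[OF this] obtain e :: real where e: "y < 1 / (1 + e)" "0 < e" "e < 1"
      by auto
    obtain C where C: "\<forall>k. (1 - e) * real k - C \<le> ev k \<and> ev k \<le> (1 + e) * real k + C"
      using ev[OF e(2,3)] by blast
    have "((\<lambda>t. t * (exp (- t * C) / (1 - exp (- t * (1 + e))))) \<longlongrightarrow> 1 / (1 + e)) (at_right 0)"
      using e by real_asymp (simp add: field_simps)
    from order_tendstoD(1)[OF this e(1)] eventually_at_right_less[of 0]
    show "eventually (\<lambda>t. y < t * (\<Sum>k. exp (- t * ev k))) (at_right 0)"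
    proof eventually_elim
      case (elim t)
      have "t * (exp (- t * C) / (1 - exp (- t * (1 + e)))) \<le> t * (\<Sum>k. exp (- t * ev k))"
        using bounds(3)[OF elim(2) e(2,3) C] elim(2) by (intro mult_left_mono) auto
      thus ?case using elim(1) by linarith
    qed
  next
    fix y :: real assume y: "y > 1"
    have "((\<lambda>e::real. 1 / (1 - e)) \<longlongrightarrow> 1) (at_right 0)" by real_asymp
    from order_tendstoD(2)[OF this y] eventually_at_right_real[of 0 "1::real"]
    have "eventually (\<lambda>e. y > 1 / (1 - e) \<and> e \<in> {0<..<1}) (at_right (0::real))"
      by (auto intro: eventually_conj)
    from eventually_happens[OF this] obtain e :: real where e: "y > 1 / (1 - e)" "0 < e" "e < 1"
      by auto
    obtain C where C: "\<forall>k. (1 - e) * real k - C \<le> ev k \<and> ev k \<le> (1 + e) * real k + C"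
      using ev[OF e(2,3)] by blast
    define p where "p = 1 - e"
    have "p > 0" using e by (simp add: p_def)
    have "((\<lambda>t. t * (exp (t * C) / (1 - exp (- t * p)))) \<longlongrightarrow> 1 / p) (at_right 0)"
      using \<open>p > 0\<close> by real_asymp (simp add: field_simps)
    from order_tendstoD(2)[OF this, of y] e(1) eventually_at_right_less[of 0]
    have "eventually (\<lambda>t. t * (exp (t * C) / (1 - exp (- t * p))) < y \<and> t > 0) (at_right 0)"
      by (auto simp: p_def intro: eventually_conj)
    thus "eventually (\<lambda>t. y > t * (\<Sum>k. exp (- t * ev k))) (at_right 0)"
    proof eventually_elim
      case (elim t)
      hence t: "t > 0" by simp
      have "t * (\<Sum>k. exp (- t * ev k)) \<le> t * (exp (t * C) / (1 - exp (- t * p)))"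
        using bounds(2)[OF t e(2,3) C] t by (intro mult_left_mono) (auto simp: p_def)
      thus ?case using elim by linarith
    qed
  qed
qed

section \<open>Parity decomposition of the Rabi Hamiltonian\<close>

lemma state_vector_space: "vector_space state_scale"
  by unfold_locales
    (auto simp: state_scale_def algebra_simps plus_fun_def prod_eq_iff)

text \<open>At \<open>n = 0\<close> the truncated index \<open>n - 1\<close> is harmless, since its
  coefficient \<open>sqrt 0\<close> vanishes.\<close>

definition parity_chain :: "real \<Rightarrow> real \<Rightarrow> real \<Rightarrow> (nat \<Rightarrow> complex) \<Rightarrow> bool" where
  "parity_chain g d E x \<longleftrightarrow> (\<forall>n. of_real (rabi_diag d n) * x n
     + of_real g * (of_real (sqrt (real n + 1)) * x (Suc n) + of_real (sqrt (real n)) * x (n - 1)) = of_real E * x n)"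

text \<open>The coupling moves \<open>n\<close> by one and flips the spin, so it conserves
  \<open>(-1) ^ n * sigma_z\<close>. At every level each parity owns exactly one coefficient, and
  \<open>\<Delta> * sigma_z\<close> becomes the alternating term of
  \<open>rabi_diag\<close>.\<close>

definition even_part :: "(nat \<Rightarrow> complex) \<times> (nat \<Rightarrow> complex) \<Rightarrow> nat \<Rightarrow> complex" where
  "even_part \<psi> n = (if even n then fst \<psi> n else snd \<psi> n)"

definition odd_part :: "(nat \<Rightarrow> complex) \<times> (nat \<Rightarrow> complex) \<Rightarrow> nat \<Rightarrow> complex" where
  "odd_part \<psi> n = (if even n then snd \<psi> n else fst \<psi> n)"

lemma rabi_eigen_iff_chains:
  "rabi_apply g \<Delta> \<psi> = state_scale (of_real E) \<psi> \<longleftrightarrow>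
     parity_chain g \<Delta> E (even_part \<psi>) \<and> parity_chain g (- \<Delta>) E (odd_part \<psi>)"
proof -
  define P where "P n \<longleftrightarrow> fst (rabi_apply g \<Delta> \<psi>) n = of_real E * fst \<psi> n" for n
  define R where "R n \<longleftrightarrow> snd (rabi_apply g \<Delta> \<psi>) n = of_real E * snd \<psi> n" for n
  \<comment> \<open>At \<open>n = 0\<close> the predecessor \<open>0 - 1 = 0\<close> has the wrong
    parity, but it is multiplied by 0.\<close>
  have prev: "of_real (sqrt (real n)) * even_part \<psi> (n - 1) =
      of_real (sqrt (real n)) * (if even n then snd \<psi> (n - 1) else fst \<psi> (n - 1))"
    "of_real (sqrt (real n)) * odd_part \<psi> (n - 1) =
      of_real (sqrt (real n)) * (if even n then fst \<psi> (n - 1) else snd \<psi> (n - 1))" for n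
    by (cases n; simp add: even_part_def odd_part_def)+
  have "rabi_apply g \<Delta> \<psi> = state_scale (of_real E) \<psi> \<longleftrightarrow> (\<forall>n. P n \<and> R n)"
    by (auto simp: prod_eq_iff state_scale_def fun_eq_iff P_def R_def)
  \<comment> \<open>The equations at each level are regrouped by parity instead of by spin.\<close>
  also have "\<dots> \<longleftrightarrow> (\<forall>n. (if even n then P n else R n)) \<and> (\<forall>n. (if even n then R n else P n))"
    by meson
  also have "(\<forall>n. (if even n then P n else R n)) \<longleftrightarrow> parity_chain g \<Delta> E (even_part \<psi>)"
    unfolding parity_chain_def prev
    by (intro all_cong1) (simp add: P_def R_def rabi_apply_def rabi_diag_def even_part_def algebra_simps)
  also have "(\<forall>n. (if even n then R n else P n)) \<longleftrightarrow> parity_chain g (- \<Delta>) E (odd_part \<psi>)"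
    unfolding parity_chain_def prev
    by (intro all_cong1) (simp add: P_def R_def rabi_apply_def rabi_diag_def odd_part_def algebra_simps)
  finally show ?thesis .
qed

definition chain_sol :: "real \<Rightarrow> real \<Rightarrow> real \<Rightarrow> nat \<Rightarrow> complex" where
  "chain_sol g d E n = of_real ((-1) ^ n * jacobi_sol (rabi_offdiag g) (rabi_diag d) E n)"

lemma chain_sol_0 [simp]: "chain_sol g d E 0 = 1"
  by (simp add: chain_sol_def)

lemma parity_chain_sol:
  assumes "g > 0"
  shows "parity_chain g d E (chain_sol g d E)"
  unfolding parity_chain_def
proof
  fix n
  define Q where "Q = jacobi_sol (rabi_offdiag g) (rabi_diag d) E"
  have "rabi_diag d n * ((-1) ^ n * Q n) + g * (sqrt (real n + 1) * ((-1) ^ Suc n * Q (Suc n))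
      + sqrt (real n) * ((-1) ^ (n - 1) * Q (n - 1))) = E * ((-1) ^ n * Q n)"
  proof (cases n)
    case 0
    show ?thesis using assms unfolding 0 by (simp add: Q_def rabi_offdiag_def)
  next
    case (Suc m)
    have "g * sqrt (real m + 2) * Q (Suc (Suc m)) = (rabi_diag d (Suc m) - E) * Q (Suc m) - g * sqrt (real m + 1) * Q m"
      using assms by (simp add: Q_def rabi_offdiag_def add_ac)
    hence "(-1) ^ m * (g * sqrt (real m + 2) * Q (Suc (Suc m))) =
      (-1) ^ m * ((rabi_diag d (Suc m) - E) * Q (Suc m) - g * sqrt (real m + 1) * Q m)" by simp
    thus ?thesis unfolding Suc by (simp add: algebra_simps)
  qed
  from arg_cong[OF this, of complex_of_real]
  show "of_real (rabi_diag d n) * chain_sol g d E n + of_real g * (of_real (sqrt (real n + 1)) *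
      chain_sol g d E (Suc n) + of_real (sqrt (real n)) * chain_sol g d E (n - 1)) =
      of_real E * chain_sol g d E n"
    by (simp only: chain_sol_def Q_def of_real_add of_real_mult)
qed

lemma parity_chain_scale: "parity_chain g d E x \<Longrightarrow> parity_chain g d E (\<lambda>n. c * x n)"
  unfolding parity_chain_def
proof
  fix n
  assume *: "\<forall>n. complex_of_real (rabi_diag d n) * x n + complex_of_real g * (complex_of_real (sqrt (real n + 1)) * x (Suc n) +
        complex_of_real (sqrt (real n)) * x (n - 1)) = complex_of_real E * x n"
  from arg_cong[OF spec[OF *, of n], of "\<lambda>z. c * z"]
  show "complex_of_real (rabi_diag d n) * (c * x n) + complex_of_real g * (complex_of_real (sqrt (real n + 1)) * (c * x (Suc n)) +
        complex_of_real (sqrt (real n)) * (c * x (n - 1))) = complex_of_real E * (c * x n)"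
    by (simp add: algebra_simps)
qed

text \<open>One initial value suffices for a three-term recurrence here, because the equation at
  \<open>n = 0\<close> has no predecessor term and already determines the next entry.\<close>

lemma parity_chain_unique:
  assumes "g > 0" "parity_chain g d E x" "parity_chain g d E y" "x 0 = y 0"
  shows "x = y"
proof -
  have "x n = y n \<and> x (n - 1) = y (n - 1)" for n
  proof (induction n)
    case (Suc n)
    have "of_real (rabi_diag d n) * x n
       + of_real g * (of_real (sqrt (real n + 1)) * x (Suc n) + of_real (sqrt (real n)) * x (n - 1)) = of_real E * x n"
     "of_real (rabi_diag d n) * y n
       + of_real g * (of_real (sqrt (real n + 1)) * y (Suc n) + of_real (sqrt (real n)) * y (n - 1)) = of_real E * y n"
      using assms(2,3) unfolding parity_chain_def by blast+
    hence "of_real g * (complex_of_real (sqrt (real n + 1)) * x (Suc n)) =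
           of_real g * (of_real (sqrt (real n + 1)) * y (Suc n))"
      unfolding conjunct1[OF Suc] conjunct2[OF Suc] distrib_left by (metis add_left_imp_eq add_right_imp_eq)
    moreover have "complex_of_real (sqrt (real n + 1)) \<noteq> 0"
      by (metis of_nat_0_le_iff of_real_eq_0_iff real_sqrt_eq_zero_cancel_iff add_nonneg_eq_0_iff zero_le_one zero_neq_one)
    ultimately show ?case using Suc assms(1) by simp
  qed (use assms in simp)
  thus ?thesis by auto
qed

lemma parity_chain_iff:
  assumes "g > 0"
  shows "parity_chain g d E x \<longleftrightarrow> x = (\<lambda>n. x 0 * chain_sol g d E n)"
proof
  assume "parity_chain g d E x"
  thus "x = (\<lambda>n. x 0 * chain_sol g d E n)"
    by (rule parity_chain_unique[OF assms]) (use parity_chain_scale parity_chain_sol[OF assms] in auto)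
next
  assume "x = (\<lambda>n. x 0 * chain_sol g d E n)"
  thus "parity_chain g d E x"
    using parity_chain_scale[OF parity_chain_sol[OF assms]] by metis
qed

text \<open>On the spectrum geometric decay supplies a majorant; off it the terms do not tend to 0,
  so their squares cannot be summable.\<close>

lemma l2seq_chain_sol_iff:
  assumes "g > 0"
  shows "l2seq (\<lambda>n. c * chain_sol g d E n) \<longleftrightarrow> c = 0 \<or> E \<in> rabi_parity_spectrum g d"
proof -
  interpret jacobi "rabi_offdiag g" "rabi_diag d" "- g\<^sup>2 - \<bar>d\<bar>" g by (rule rabi_jacobi[OF assms])
  have PS: "rabi_parity_spectrum g d = point_spectrum"
    by (simp add: point_spectrum_def rabi_parity_spectrum_def)
  have norm: "(cmod (c * chain_sol g d E n))\<^sup>2 = (cmod c)\<^sup>2 * (Q E n)\<^sup>2" for n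
    by (simp add: chain_sol_def norm_mult power_mult_distrib norm_power)
  have "summable (\<lambda>n. (Q E n)\<^sup>2) \<longleftrightarrow> E \<in> point_spectrum"
  proof
    assume "summable (\<lambda>n. (Q E n)\<^sup>2)"
    hence "(\<lambda>n. (Q E n)\<^sup>2) \<longlonglongrightarrow> 0" by (rule summable_LIMSEQ_zero)
    hence "(\<lambda>n. sqrt ((Q E n)\<^sup>2)) \<longlonglongrightarrow> sqrt 0" by (rule tendsto_real_sqrt)
    thus "E \<in> point_spectrum" by (simp add: point_spectrum_def tendsto_rabs_zero_iff)
  next
    assume "E \<in> point_spectrum"
    then obtain C where C: "\<And>n. \<bar>Q E n\<bar> \<le> C / 2 ^ n" using spectrum_geometric by blast
    have "summable (\<lambda>n. C\<^sup>2 * (1 / 4) ^ n)" by (intro summable_mult summable_geometric) auto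
    thus "summable (\<lambda>n. (Q E n)\<^sup>2)"
    proof (rule summable_comparison_test')
      fix n
      have "(Q E n)\<^sup>2 \<le> (C / 2 ^ n)\<^sup>2"
        using power_mono[OF C[of n], of 2] by simp
      also have "\<dots> = C\<^sup>2 * (1 / 4) ^ n"
        by (simp add: power_divide power_mult_distrib power2_eq_square flip: power_mult_distrib)
      finally show "norm ((Q E n)\<^sup>2) \<le> C\<^sup>2 * (1 / 4) ^ n" by simp
    qed
  qed
  thus ?thesis unfolding l2seq_def norm PS by (auto simp: summable_cmult_iff)
qed

lemma l2seq_parts_iff:
  "l2seq (fst \<psi>) \<and> l2seq (snd \<psi>) \<longleftrightarrow> l2seq (even_part \<psi>) \<and> l2seq (odd_part \<psi>)"
proof -
  have dom: "l2seq z" if "l2seq x" "l2seq y" "\<And>n. z n = x n \<or> z n = y n" for x y z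
  proof -
    have "summable (\<lambda>n. (cmod (x n))\<^sup>2 + (cmod (y n))\<^sup>2)"
      using that(1,2) by (intro summable_add) (auto simp: l2seq_def)
    thus ?thesis unfolding l2seq_def
    proof (rule summable_comparison_test')
      fix n show "norm ((cmod (z n))\<^sup>2) \<le> (cmod (x n))\<^sup>2 + (cmod (y n))\<^sup>2"
        using that(3)[of n] by auto
    qed
  qed
  have "l2seq (even_part \<psi>)" "l2seq (odd_part \<psi>)" if "l2seq (fst \<psi>)" "l2seq (snd \<psi>)"
    by (rule dom[OF that]; auto simp: even_part_def odd_part_def)+
  moreover have "l2seq (fst \<psi>)" "l2seq (snd \<psi>)" if "l2seq (even_part \<psi>)" "l2seq (odd_part \<psi>)"
    by (rule dom[OF that]; auto simp: even_part_def odd_part_def)+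
  ultimately show ?thesis by blast
qed

definition even_state :: "(nat \<Rightarrow> complex) \<Rightarrow> (nat \<Rightarrow> complex) \<times> (nat \<Rightarrow> complex)" where
  "even_state x = ((\<lambda>n. if even n then x n else 0), (\<lambda>n. if even n then 0 else x n))"

definition odd_state :: "(nat \<Rightarrow> complex) \<Rightarrow> (nat \<Rightarrow> complex) \<times> (nat \<Rightarrow> complex)" where
  "odd_state x = ((\<lambda>n. if even n then 0 else x n), (\<lambda>n. if even n then x n else 0))"

lemma state_eq_iff_parts: "\<psi> = \<phi> \<longleftrightarrow> even_part \<psi> = even_part \<phi> \<and> odd_part \<psi> = odd_part \<phi>"
proof
  assume *: "even_part \<psi> = even_part \<phi> \<and> odd_part \<psi> = odd_part \<phi>"
  have "fst \<psi> n = fst \<phi> n" "snd \<psi> n = snd \<phi> n" for n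
    using fun_cong[OF conjunct1[OF *], of n] fun_cong[OF conjunct2[OF *], of n]
    by (auto simp: even_part_def odd_part_def split: if_splits)
  thus "\<psi> = \<phi>" by (auto simp: prod_eq_iff)
qed simp

lemma even_part_comb:
  "even_part (state_scale c (even_state x) + state_scale d (odd_state y)) = (\<lambda>n. c * x n)"
  "odd_part (state_scale c (even_state x) + state_scale d (odd_state y)) = (\<lambda>n. d * y n)"
  by (auto simp: even_part_def odd_part_def state_scale_def even_state_def odd_state_def)

text \<open>The level-0 coefficients of the two parts determine the state, and each must vanish
  unless its sector has a square-summable solution.\<close>

lemma rabi_eigenspace_eq:
  assumes "g > 0"
  shows "rabi_eigenspace g \<Delta> E =
    {state_scale c (even_state (chain_sol g \<Delta> E)) + state_scale d (odd_state (chain_sol g (- \<Delta>) E)) | c d.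
      (c = 0 \<or> E \<in> rabi_parity_spectrum g \<Delta>) \<and> (d = 0 \<or> E \<in> rabi_parity_spectrum g (- \<Delta>))}" (is "_ = ?R")
proof (intro set_eqI iffI)
  fix \<psi> assume "\<psi> \<in> rabi_eigenspace g \<Delta> E"
  hence *: "l2seq (even_part \<psi>)" "l2seq (odd_part \<psi>)"
    "parity_chain g \<Delta> E (even_part \<psi>)" "parity_chain g (- \<Delta>) E (odd_part \<psi>)"
    using l2seq_parts_iff[of \<psi>] by (auto simp: rabi_eigenspace_def rabi_eigen_iff_chains)
  define c where "c = even_part \<psi> 0"
  define d where "d = odd_part \<psi> 0"
  have e: "even_part \<psi> = (\<lambda>n. c * chain_sol g \<Delta> E n)"
    using *(3) parity_chain_iff[OF assms] unfolding c_def by blast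
  have o: "odd_part \<psi> = (\<lambda>n. d * chain_sol g (- \<Delta>) E n)"
    using *(4) parity_chain_iff[OF assms] unfolding d_def by blast
  have "\<psi> = state_scale c (even_state (chain_sol g \<Delta> E)) + state_scale d (odd_state (chain_sol g (- \<Delta>) E))"
    unfolding state_eq_iff_parts even_part_comb using e o by simp
  moreover have "c = 0 \<or> E \<in> rabi_parity_spectrum g \<Delta>"
    using *(1) unfolding e l2seq_chain_sol_iff[OF assms] .
  moreover have "d = 0 \<or> E \<in> rabi_parity_spectrum g (- \<Delta>)"
    using *(2) unfolding o l2seq_chain_sol_iff[OF assms] .
  ultimately show "\<psi> \<in> ?R" by blast
next
  fix \<psi> assume "\<psi> \<in> ?R"
  then obtain c d where \<psi>: "\<psi> = state_scale c (even_state (chain_sol g \<Delta> E)) + state_scale d (odd_state (chain_sol g (- \<Delta>) E))"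
    "c = 0 \<or> E \<in> rabi_parity_spectrum g \<Delta>" "d = 0 \<or> E \<in> rabi_parity_spectrum g (- \<Delta>)" by blast
  have e: "even_part \<psi> = (\<lambda>n. c * chain_sol g \<Delta> E n)" "odd_part \<psi> = (\<lambda>n. d * chain_sol g (- \<Delta>) E n)"
    unfolding \<psi>(1) by (rule even_part_comb)+
  have "l2seq (even_part \<psi>)" "l2seq (odd_part \<psi>)"
    unfolding e l2seq_chain_sol_iff[OF assms] by (fact \<psi>)+
  moreover have "parity_chain g \<Delta> E (even_part \<psi>)" "parity_chain g (- \<Delta>) E (odd_part \<psi>)"
    unfolding e by (intro parity_chain_scale parity_chain_sol assms)+
  ultimately show "\<psi> \<in> rabi_eigenspace g \<Delta> E"
    using l2seq_parts_iff[of \<psi>] by (auto simp: rabi_eigenspace_def rabi_eigen_iff_chains)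
qed

text \<open>The sector spectra are not claimed to be disjoint: an energy in both has multiplicity 2,
  as the two states live on complementary coefficients and are independent.\<close>

lemma rabi_mult_eq:
  assumes "g > 0"
  shows "rabi_mult g \<Delta> E = (if E \<in> rabi_parity_spectrum g \<Delta> then 1 else 0)
           + (if E \<in> rabi_parity_spectrum g (- \<Delta>) then 1 else 0)"
proof -
  interpret st: vector_space state_scale by (rule state_vector_space)
  define e where "e = even_state (chain_sol g \<Delta> E)"
  define f where "f = odd_state (chain_sol g (- \<Delta>) E)"
  have e0: "even_part e 0 = 1" "odd_part e 0 = 0" "even_part f 0 = 0" "odd_part f 0 = 1"
    by (auto simp: e_def f_def even_part_def odd_part_def even_state_def odd_state_def)
  have z: "even_part 0 = (\<lambda>_. 0)" "odd_part 0 = (\<lambda>_. 0)"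
    by (auto simp: even_part_def odd_part_def)
  have ne: "e \<noteq> 0" "f \<noteq> 0" "e \<noteq> f" using e0 z by auto
  have sc: "even_part (state_scale c \<psi>) n = c * even_part \<psi> n" for c \<psi> n
    by (simp add: even_part_def state_scale_def)
  define B where "B = (if E \<in> rabi_parity_spectrum g \<Delta> then {e} else {})
           \<union> (if E \<in> rabi_parity_spectrum g (- \<Delta>) then {f} else {})"
  have "e \<notin> st.span {f}"
  proof
    assume "e \<in> st.span {f}"
    then obtain k where "e = state_scale k f" by (auto simp: st.span_singleton)
    hence "even_part e 0 = k * even_part f 0" by (simp add: sc)
    thus False using e0 by simp
  qed
  hence "st.independent {e, f}" using ne by (simp add: st.independent_insert)
  hence ind: "st.independent B" by (rule st.independent_mono) (auto simp: B_def)
  have "rabi_eigenspace g \<Delta> E = {state_scale c e + state_scale d f | c d.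
      (c = 0 \<or> E \<in> rabi_parity_spectrum g \<Delta>) \<and> (d = 0 \<or> E \<in> rabi_parity_spectrum g (- \<Delta>))}"
    unfolding e_def f_def by (rule rabi_eigenspace_eq[OF assms])
  also have "\<dots> = st.span B"
  proof (cases "E \<in> rabi_parity_spectrum g \<Delta>"; cases "E \<in> rabi_parity_spectrum g (- \<Delta>)")
    assume "E \<in> rabi_parity_spectrum g \<Delta>" "E \<in> rabi_parity_spectrum g (- \<Delta>)"
    moreover have "st.span {e, f} = {state_scale c e + state_scale d f | c d. True}"
    proof (intro set_eqI iffI)
      fix \<psi> assume "\<psi> \<in> st.span {e, f}"
      then obtain c d where "\<psi> - state_scale c e = state_scale d f"
        unfolding st.span_insert[of e "{f}"] st.span_singleton by auto
      hence "\<psi> = state_scale c e + state_scale d f" by (metis add.commute diff_add_cancel)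
      thus "\<psi> \<in> {state_scale c e + state_scale d f | c d. True}" by blast
    next
      fix \<psi> assume "\<psi> \<in> {state_scale c e + state_scale d f | c d. True}"
      then obtain c d where \<psi>: "\<psi> = state_scale c e + state_scale d f" by blast
      show "\<psi> \<in> st.span {e, f}"
        unfolding \<psi> by (intro st.span_add st.span_scale st.span_base) auto
    qed
    ultimately show ?thesis by (simp add: B_def insert_commute)
  qed (auto simp: B_def st.span_singleton)
  finally have "rabi_mult g \<Delta> E = card B"
    unfolding rabi_mult_def by (simp add: st.dim_eq_card_independent[OF ind])
  thus ?thesis using ne by (simp add: B_def)
qed

lemma rabi_spectrum_eq:
  assumes "g > 0"
  shows "rabi_spectrum g \<Delta> = rabi_parity_spectrum g \<Delta> \<union> rabi_parity_spectrum g (- \<Delta>)"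
proof -
  define e where "e E = even_state (chain_sol g \<Delta> E)" for E
  define f where "f E = odd_state (chain_sol g (- \<Delta>) E)" for E
  have sp: "rabi_eigenspace g \<Delta> E = {state_scale c (e E) + state_scale d (f E) | c d.
      (c = 0 \<or> E \<in> rabi_parity_spectrum g \<Delta>) \<and> (d = 0 \<or> E \<in> rabi_parity_spectrum g (- \<Delta>))}" for E
    unfolding e_def f_def by (rule rabi_eigenspace_eq[OF assms])
  have s: "state_scale 0 x = 0" "state_scale 1 x = x" for x by (auto simp: state_scale_def prod_eq_iff)
  have e0: "fst (e E) 0 = 1" "snd (f E) 0 = 1" for E
    by (auto simp: e_def f_def even_state_def odd_state_def)
  have ne: "e E \<noteq> 0" "f E \<noteq> 0" for E using e0[of E] by auto
  have 1: "e E \<in> rabi_eigenspace g \<Delta> E" if "E \<in> rabi_parity_spectrum g \<Delta>" for E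
    unfolding sp using that by (intro CollectI exI[of _ 1] exI[of _ 0]) (simp add: s)
  have 2: "f E \<in> rabi_eigenspace g \<Delta> E" if "E \<in> rabi_parity_spectrum g (- \<Delta>)" for E
    unfolding sp using that by (intro CollectI exI[of _ 0] exI[of _ 1]) (simp add: s)
  have 3: "rabi_eigenspace g \<Delta> E = {0}"
    if "E \<notin> rabi_parity_spectrum g \<Delta>" "E \<notin> rabi_parity_spectrum g (- \<Delta>)" for E
    unfolding sp using that by (auto simp: s)
  show ?thesis
  proof (rule set_eqI)
    fix E
    show "E \<in> rabi_spectrum g \<Delta> \<longleftrightarrow> E \<in> rabi_parity_spectrum g \<Delta> \<union> rabi_parity_spectrum g (- \<Delta>)"
      using 1[of E] 2[of E] 3[of E] ne[of E] unfolding rabi_spectrum_def mem_Collect_eq Un_iff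
      by (metis singletonD)
  qed
qed

section \<open>Spectral sums and the merged eigenvalue sequence\<close>

lemma rabi_spectral_sum:
  fixes h :: "real \<Rightarrow> 'a :: real_normed_field"
  assumes "g > 0"
    and "bij_betw ev UNIV (rabi_parity_spectrum g \<Delta>)" "bij_betw ev' UNIV (rabi_parity_spectrum g (- \<Delta>))"
    and "((\<lambda>k. h (ev k)) has_sum A) UNIV" "((\<lambda>k. h (ev' k)) has_sum B) UNIV"
  shows "((\<lambda>E. of_nat (rabi_mult g \<Delta> E) * h E) has_sum (A + B)) (rabi_spectrum g \<Delta>)"
proof -
  define S where "S = rabi_parity_spectrum g \<Delta>"
  define T where "T = rabi_parity_spectrum g (- \<Delta>)"
  have "((\<lambda>E. if E \<in> S then h E else 0) has_sum A) (S \<union> T)"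
  proof -
    have "(h has_sum A) S"
      using has_sum_reindex_bij_betw[OF assms(2), of h A] assms(4) by (simp add: S_def)
    thus ?thesis by (rule iffD1[OF has_sum_cong_neutral, rotated -1]) auto
  qed
  moreover have "((\<lambda>E. if E \<in> T then h E else 0) has_sum B) (S \<union> T)"
  proof -
    have "(h has_sum B) T"
      using has_sum_reindex_bij_betw[OF assms(3), of h B] assms(5) by (simp add: T_def)
    thus ?thesis by (rule iffD1[OF has_sum_cong_neutral, rotated -1]) auto
  qed
  ultimately have "((\<lambda>E. (if E \<in> S then h E else 0) + (if E \<in> T then h E else 0)) has_sum (A + B)) (S \<union> T)"
    by (rule has_sum_add)
  also have "S \<union> T = rabi_spectrum g \<Delta>" by (simp add: rabi_spectrum_eq[OF assms(1)] S_def T_def)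
  also have "(\<lambda>E. (if E \<in> S then h E else 0) + (if E \<in> T then h E else 0)) = (\<lambda>E. of_nat (rabi_mult g \<Delta> E) * h E)"
    by (auto simp: rabi_mult_eq[OF assms(1)] S_def T_def fun_eq_iff)
  finally show ?thesis .
qed

lemma has_sum_interleave:
  fixes f f' :: "nat \<Rightarrow> 'a :: real_normed_vector"
  assumes "(f has_sum A) UNIV" "(f' has_sum B) UNIV"
  shows "((\<lambda>n. if even n then f (n div 2) else f' (n div 2)) has_sum (A + B)) UNIV"
proof -
  define h where "h n = (if even n then f (n div 2) else f' (n div 2))" for n
  have "(h has_sum A) {n. even n} \<longleftrightarrow> (f has_sum A) UNIV"
    by (rule has_sum_reindex_bij_witness[of _ "\<lambda>n. 2 * n" "\<lambda>n. n div 2"]) (auto simp: h_def)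
  moreover have "(h has_sum B) {n. odd n} \<longleftrightarrow> (f' has_sum B) UNIV"
    by (rule has_sum_reindex_bij_witness[of _ "\<lambda>n. 2 * n + 1" "\<lambda>n. n div 2"]) (auto simp: h_def)
  ultimately have "(h has_sum (A + B)) ({n. even n} \<union> {n. odd n})"
    using assms by (intro has_sum_Un_disjoint) auto
  moreover have "{n. even n} \<union> {n. odd n} = (UNIV :: nat set)" by auto
  ultimately have "(h has_sum (A + B)) UNIV" by simp
  thus ?thesis by (simp add: h_def [abs_def])
qed

text \<open>Interface to the analytic part. The sector sequences are interleaved and need not be
  sorted, since only a linear lower bound and absolutely convergent sums matter from here
  on.\<close>

lemma rabi_spectrum_sequence:
  assumes "g > 0" "\<Delta> > 0" "\<tau> > g\<^sup>2 + \<Delta>"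
  obtains \<mu> :: "nat \<Rightarrow> real" and c where "c > 0" "\<forall>j. \<mu> j + \<tau> \<ge> c * (real j + 1)"
    "((\<lambda>t. t * (\<Sum>j. exp (- t * \<mu> j))) \<longlongrightarrow> 2) (at_right 0)"
    "\<forall>t>0. (\<lambda>j. exp (- t * \<mu> j)) sums Z_Rabi g \<Delta> t"
    "\<forall>s. summable (\<lambda>j. norm (complex_of_real (\<mu> j + \<tau>) powr (- s))) \<longrightarrow>
       zeta_QRM g \<Delta> s \<tau> = (\<Sum>j. complex_of_real (\<mu> j + \<tau>) powr (- s))"
proof -
  obtain ev where ev: "bij_betw ev UNIV (rabi_parity_spectrum g \<Delta>)"
    "\<And>e. 0 < e \<Longrightarrow> e < 1 \<Longrightarrow> \<exists>C. \<forall>k. (1 - e) * real k - C \<le> ev k \<and> ev k \<le> (1 + e) * real k + C"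
    using rabi_parity_spectrum_enum[OF assms(1)] by metis
  obtain ev' where ev': "bij_betw ev' UNIV (rabi_parity_spectrum g (- \<Delta>))"
    "\<And>e. 0 < e \<Longrightarrow> e < 1 \<Longrightarrow> \<exists>C. \<forall>k. (1 - e) * real k - C \<le> ev' k \<and> ev' k \<le> (1 + e) * real k + C"
    using rabi_parity_spectrum_enum[OF assms(1)] by metis
  define \<mu> where "\<mu> n = (if even n then ev (n div 2) else ev' (n div 2))" for n
  define \<delta> where "\<delta> = \<tau> - g\<^sup>2 - \<Delta>"
  have \<delta>: "\<delta> > 0" using assms by (simp add: \<delta>_def)
  have ge: "\<mu> n + \<tau> \<ge> \<delta>" for n
  proof -
    have "\<mu> n \<in> rabi_parity_spectrum g \<Delta> \<union> rabi_parity_spectrum g (- \<Delta>)"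
      using ev(1) ev'(1) by (auto simp: \<mu>_def bij_betw_def)
    hence "\<mu> n \<ge> - g\<^sup>2 - \<bar>\<Delta>\<bar>"
      using rabi_parity_spectrum_ge[OF assms(1), of "\<mu> n" \<Delta>] rabi_parity_spectrum_ge[OF assms(1), of "\<mu> n" "- \<Delta>"] by auto
    thus ?thesis using assms by (simp add: \<delta>_def)
  qed
  obtain C1 where C1: "\<And>k. ev k \<ge> real k / 2 - C1" using ev(2)[of "1/2"] by auto
  obtain C2 where C2: "\<And>k. ev' k \<ge> real k / 2 - C2" using ev'(2)[of "1/2"] by auto
  define K where "K = \<bar>C1\<bar> + \<bar>C2\<bar> + \<bar>\<tau>\<bar> + 1"
  have K: "K > 0" by (simp add: K_def)
  have lin: "\<mu> n + \<tau> \<ge> (real n + 1) / 4 - K" for n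
  proof -
    have "n \<le> 2 * (n div 2) + 1" by linarith
    hence "real n \<le> real (2 * (n div 2) + 1)" by (simp only: of_nat_le_iff)
    define m where "m = n div 2"
    have m: "real m \<ge> (real n - 1) / 2" using \<open>real n \<le> real (2 * (n div 2) + 1)\<close> by (simp add: m_def)
    have "\<mu> n = ev m \<or> \<mu> n = ev' m" by (simp add: \<mu>_def m_def)
    moreover have "(real n + 1) / 4 \<le> real m / 2 + 1" using m by simp
    hence "(real n + 1) / 4 - K \<le> ev m + \<tau>" "(real n + 1) / 4 - K \<le> ev' m + \<tau>"
      using C1[of m] C2[of m] unfolding K_def by linarith+
    ultimately show ?thesis by auto
  qed
  \<comment> \<open>Merges the positive but constant bound \<open>\<delta>\<close> with the linear
    but possibly negative \<open>(j + 1) / 4 - K\<close>: \<open>K\<close> times the first plus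
    \<open>\<delta>\<close> times the second has no offset left.\<close>
  define c where "c = \<delta> / (4 * (\<delta> + K))"
  have c: "c > 0" using \<delta> K by (simp add: c_def)
  have cb: "\<mu> j + \<tau> \<ge> c * (real j + 1)" for j
  proof -
    have "K * \<delta> \<le> K * (\<mu> j + \<tau>)" using ge[of j] K by (intro mult_left_mono) auto
    moreover have "real j + 1 \<le> 4 * (\<mu> j + \<tau>) + 4 * K"
      using lin[of j] by (simp add: field_simps)
    hence "\<delta> * (real j + 1) \<le> \<delta> * (4 * (\<mu> j + \<tau>) + 4 * K)"
      using \<delta> by (intro mult_left_mono) auto
    ultimately have "\<delta> * (real j + 1) \<le> 4 * (\<delta> + K) * (\<mu> j + \<tau>)"
      by (simp add: algebra_simps)
    thus ?thesis using \<delta> K by (simp add: c_def field_simps)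
  qed

  have trace: "((\<lambda>j. exp (- t * \<mu> j)) has_sum ((\<Sum>k. exp (- t * ev k)) + (\<Sum>k. exp (- t * ev' k)))) UNIV"
    "((\<lambda>E. of_nat (rabi_mult g \<Delta> E) * exp (- t * E)) has_sum ((\<Sum>k. exp (- t * ev k)) + (\<Sum>k. exp (- t * ev' k)))) (rabi_spectrum g \<Delta>)"
    if t: "t > 0" for t
  proof -
    have 1: "((\<lambda>k. exp (- t * ev k)) has_sum (\<Sum>k. exp (- t * ev k))) UNIV"
      using heat_trace_asymptotics(1)[OF ev(2) t] by (intro sums_nonneg_imp_has_sum summable_sums) auto
    have 2: "((\<lambda>k. exp (- t * ev' k)) has_sum (\<Sum>k. exp (- t * ev' k))) UNIV"
      using heat_trace_asymptotics(1)[OF ev'(2) t] by (intro sums_nonneg_imp_has_sum summable_sums) auto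
    show "((\<lambda>j. exp (- t * \<mu> j)) has_sum ((\<Sum>k. exp (- t * ev k)) + (\<Sum>k. exp (- t * ev' k)))) UNIV"
      using has_sum_interleave[OF 1 2] by (simp add: \<mu>_def if_distrib cong: if_cong)
    show "((\<lambda>E. of_nat (rabi_mult g \<Delta> E) * exp (- t * E)) has_sum ((\<Sum>k. exp (- t * ev k)) + (\<Sum>k. exp (- t * ev' k)))) (rabi_spectrum g \<Delta>)"
      by (rule rabi_spectral_sum[OF assms(1) ev(1) ev'(1) 1 2])
  qed
  have Z: "(\<lambda>j. exp (- t * \<mu> j)) sums Z_Rabi g \<Delta> t"
    "Z_Rabi g \<Delta> t = (\<Sum>k. exp (- t * ev k)) + (\<Sum>k. exp (- t * ev' k))" if t: "t > 0" for t
  proof -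
    show eq: "Z_Rabi g \<Delta> t = (\<Sum>k. exp (- t * ev k)) + (\<Sum>k. exp (- t * ev' k))"
      unfolding Z_Rabi_def using trace(2)[OF t] by (intro infsumI) simp
    show "(\<lambda>j. exp (- t * \<mu> j)) sums Z_Rabi g \<Delta> t"
      unfolding eq using trace(1)[OF t] by (rule has_sum_imp_sums)
  qed
  have "((\<lambda>t. t * (\<Sum>k. exp (- t * ev k)) + t * (\<Sum>k. exp (- t * ev' k))) \<longlongrightarrow> 1 + 1) (at_right 0)"
    by (intro tendsto_add heat_trace_asymptotics(2) ev(2) ev'(2))
  moreover have "eventually (\<lambda>t. t * (\<Sum>k. exp (- t * ev k)) + t * (\<Sum>k. exp (- t * ev' k)) =
      t * (\<Sum>j. exp (- t * \<mu> j))) (at_right 0)"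
    using eventually_at_right_less[of 0]
    by eventually_elim (metis Z distrib_left sums_unique)
  ultimately have lim: "((\<lambda>t. t * (\<Sum>j. exp (- t * \<mu> j))) \<longlongrightarrow> 2) (at_right 0)"
    by (auto elim: Lim_transform_eventually)

  have zeta: "zeta_QRM g \<Delta> s \<tau> = (\<Sum>j. complex_of_real (\<mu> j + \<tau>) powr (- s))"
    if sm: "summable (\<lambda>j. norm (complex_of_real (\<mu> j + \<tau>) powr (- s)))" for s
  proof -
    define h where "h x = complex_of_real (x + \<tau>) powr (- s)" for x
    have sm': "summable (\<lambda>j. norm (h (\<mu> j)))" using sm by (simp add: h_def)
    have on: "(\<lambda>j. h (\<mu> j)) summable_on UNIV" by (rule norm_summable_imp_summable_on[OF sm'])
    have "(\<lambda>k. h (ev k)) summable_on UNIV \<longleftrightarrow> (\<lambda>j. h (\<mu> j)) summable_on {n. even n}"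
      by (rule summable_on_reindex_bij_witness[of _ "\<lambda>n. n div 2" "\<lambda>n. 2 * n"]) (auto simp: \<mu>_def)
    hence 1: "((\<lambda>k. h (ev k)) has_sum (infsum (\<lambda>k. h (ev k)) UNIV)) UNIV"
      using summable_on_subset_banach[OF on] by (intro has_sum_infsum) auto
    have "(\<lambda>k. h (ev' k)) summable_on UNIV \<longleftrightarrow> (\<lambda>j. h (\<mu> j)) summable_on {n. odd n}"
      by (rule summable_on_reindex_bij_witness[of _ "\<lambda>n. n div 2" "\<lambda>n. 2 * n + 1"]) (auto simp: \<mu>_def)
    hence 2: "((\<lambda>k. h (ev' k)) has_sum (infsum (\<lambda>k. h (ev' k)) UNIV)) UNIV"
      using summable_on_subset_banach[OF on] by (intro has_sum_infsum) auto
    have "((\<lambda>j. h (\<mu> j)) has_sum (infsum (\<lambda>k. h (ev k)) UNIV + infsum (\<lambda>k. h (ev' k)) UNIV)) UNIV"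
      using has_sum_interleave[OF 1 2] by (simp add: \<mu>_def if_distrib cong: if_cong)
    hence "(\<lambda>j. h (\<mu> j)) sums (infsum (\<lambda>k. h (ev k)) UNIV + infsum (\<lambda>k. h (ev' k)) UNIV)"
      by (rule has_sum_imp_sums)
    moreover have "zeta_QRM g \<Delta> s \<tau> = infsum (\<lambda>k. h (ev k)) UNIV + infsum (\<lambda>k. h (ev' k)) UNIV"
      unfolding zeta_QRM_def using rabi_spectral_sum[OF assms(1) ev(1) ev'(1) 1 2]
      by (intro infsumI) (simp add: h_def)
    ultimately show ?thesis by (simp add: sums_iff h_def)
  qed
  show ?thesis using that[of c \<mu>] c cb lim Z(1) zeta by blast
qed

section \<open>Mellin transform of the heat trace\<close>

lemma norm_of_real_powr: "x > 0 \<Longrightarrow> norm (complex_of_real x powr z) = x powr Re z"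
  by (simp add: norm_powr_real_powr)

text \<open>Substitution of \<open>a * x\<close> in Euler's integral, in Bochner form so that
  \<open>mellin_heat\<close> can exchange it with the sum over the spectrum.\<close>

lemma Gamma_integral_scaled:
  assumes "Re z > 0" "a > 0"
  shows "has_bochner_integral lebesgue
    (\<lambda>x. indicator {0<..} x *\<^sub>R (complex_of_real x powr (z - 1) * of_real (exp (- a * x))))
    (Gamma z * of_real a powr (- z))"
proof -
  define f where "f x = indicator {0<..} x *\<^sub>R (complex_of_real x powr (z - 1) / of_real (exp x))" for x :: real
  have si: "set_integrable lebesgue {0<..} (\<lambda>x. complex_of_real x powr (z - 1) / of_real (exp x))"
    by (rule absolutely_integrable_Gamma_integral'[OF assms(1)])
  have "has_bochner_integral lebesgue f (Gamma z)"
    using si set_lebesgue_integral_eq_integral(2)[OF si] integral_unique[OF Gamma_integral_complex'[OF assms(1)]]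
    by (simp add: has_bochner_integral_iff set_integrable_def set_lebesgue_integral_def f_def [abs_def])
  hence "has_bochner_integral lebesgue (\<lambda>x. f (0 + a * x)) (Gamma z /\<^sub>R \<bar>a\<bar>)"
    using assms(2) by (subst (asm) has_bochner_integral_lebesgue_real_affine_iff[of a _ _ 0]) auto
  hence "has_bochner_integral lebesgue (\<lambda>x. of_real a powr (1 - z) * f (0 + a * x))
      (of_real a powr (1 - z) * (Gamma z /\<^sub>R \<bar>a\<bar>))"
    by (rule has_bochner_integral_mult_right)
  also have "of_real a powr (1 - z) * (Gamma z /\<^sub>R \<bar>a\<bar>) = Gamma z * of_real a powr (- z)"
    using assms(2) by (simp add: powr_diff powr_minus scaleR_conv_of_real field_simps)
  also have "(\<lambda>x. of_real a powr (1 - z) * f (0 + a * x)) =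
    (\<lambda>x. indicator {0<..} x *\<^sub>R (complex_of_real x powr (z - 1) * of_real (exp (- a * x))))"
  proof
    fix x
    show "of_real a powr (1 - z) * f (0 + a * x) =
      indicator {0<..} x *\<^sub>R (complex_of_real x powr (z - 1) * of_real (exp (- a * x)))"
    proof (cases "x > 0")
      case True
      have "complex_of_real (a * x) powr (z - 1) = of_real a powr (z - 1) * of_real x powr (z - 1)"
        using True assms(2) by (simp add: powr_times_real)
      moreover have "complex_of_real a powr (1 - z) * of_real a powr (z - 1) = 1"
        using assms(2) by (simp flip: powr_add)
      ultimately have "complex_of_real a powr (1 - z) * complex_of_real (a * x) powr (z - 1) = of_real x powr (z - 1)"
        by (simp add: mult.assoc[symmetric])
      thus ?thesis using True assms(2)
        by (simp add: f_def exp_minus field_simps zero_less_mult_iff)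
    next
      case False
      thus ?thesis using assms(2) by (simp add: f_def zero_less_mult_iff)
    qed
  qed
  finally show ?thesis .
qed

locale linear_growth =
  fixes \<alpha> :: "nat \<Rightarrow> real" and c :: real
  assumes c_pos: "c > 0" and \<alpha>_ge: "\<And>j. \<alpha> j \<ge> c * (real j + 1)"
begin

definition heat :: "real \<Rightarrow> real" where "heat x = (\<Sum>j. exp (- \<alpha> j * x))"

definition dirichlet :: "complex \<Rightarrow> complex" where "dirichlet s = (\<Sum>j. of_real (\<alpha> j) powr (- s))"

lemma \<alpha>_ge_c: "\<alpha> j \<ge> c"
proof -
  have "c * 1 \<le> c * (real j + 1)" using c_pos by (intro mult_left_mono) auto
  thus ?thesis using \<alpha>_ge[of j] by simp
qed

lemma \<alpha>_pos: "\<alpha> j > 0"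
  using \<alpha>_ge_c[of j] c_pos by linarith

lemma heat_geometric:
  assumes "x > 0"
  shows "summable (\<lambda>j. exp (- \<alpha> j * x))" "0 \<le> heat x" "heat x \<le> exp (- c * x) / (1 - exp (- c * x))"
proof -
  have up: "(\<lambda>j. exp (- x * (c * real j + c))) sums (exp (- x * c) / (1 - exp (- x * c)))"
    by (rule exp_sum_geometric) (use assms c_pos in auto)
  have le: "exp (- \<alpha> j * x) \<le> exp (- x * (c * real j + c))" for j
    using mult_right_mono[OF \<alpha>_ge[of j], of x] assms by (simp add: algebra_simps)
  show sm: "summable (\<lambda>j. exp (- \<alpha> j * x))"
    by (rule summable_comparison_test'[OF sums_summable[OF up]]) (use le in simp)
  show "0 \<le> heat x" unfolding heat_def by (intro suminf_nonneg sm) auto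
  show "heat x \<le> exp (- c * x) / (1 - exp (- c * x))"
    unfolding heat_def using sums_le[OF le summable_sums[OF sm] up] by (simp add: mult.commute)
qed

text \<open>\<open>p\<close> is kept apart from \<open>Re s\<close> so that one summable majorant
  serves a whole neighbourhood of \<open>s\<close>.\<close>

lemma powr_majorant:
  assumes "1 < p" "p \<le> Re s"
  shows "norm (complex_of_real (\<alpha> j) powr (- s)) \<le> c powr (- Re s) * (real j + 1) powr (- p)"
proof -
  have "norm (complex_of_real (\<alpha> j) powr (- s)) = \<alpha> j powr (- Re s)"
    using \<alpha>_pos by (simp add: norm_of_real_powr)
  also have "\<dots> \<le> (c * (real j + 1)) powr (- Re s)"
    using \<alpha>_ge[of j] c_pos assms by (intro powr_mono2') auto
  also have "\<dots> = c powr (- Re s) * (real j + 1) powr (- Re s)"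
    using c_pos by (simp add: powr_mult)
  also have "\<dots> \<le> c powr (- Re s) * (real j + 1) powr (- p)"
    using assms by (intro mult_left_mono powr_mono) auto
  finally show ?thesis .
qed

lemma summable_shifted_powr:
  assumes "p > 1"
  shows "summable (\<lambda>j. (real j + 1) powr (- p))"
  using summable_Suc_iff[of "\<lambda>n. real n powr (- p)"] assms
  by (simp add: summable_real_powr_iff add.commute)

lemma summable_dirichlet:
  assumes "Re s > 1"
  shows "summable (\<lambda>j. norm (complex_of_real (\<alpha> j) powr (- s)))"
proof (rule summable_comparison_test')
  show "summable (\<lambda>j. c powr (- Re s) * (real j + 1) powr (- Re s))"
    using assms by (intro summable_mult summable_shifted_powr)
  show "norm (norm (complex_of_real (\<alpha> j) powr (- s))) \<le> c powr (- Re s) * (real j + 1) powr (- Re s)" for j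
    using powr_majorant[OF assms order_refl, of j] by simp
qed

lemma holomorphic_dirichlet: "dirichlet holomorphic_on {s. Re s > 1}"
proof (rule holomorphic_uniform_sequence)
  show "open {s. Re s > 1}" by (rule open_halfspace_Re_gt)
  show "(\<lambda>s. \<Sum>j<n. complex_of_real (\<alpha> j) powr (- s)) holomorphic_on {s. Re s > 1}" for n
    by (intro holomorphic_intros)
  fix s assume s: "s \<in> {s. Re s > 1}"
  \<comment> \<open>Half the distance to the boundary line, so that \<open>Re z \<ge> 1 + d\<close>
    on the closed disc.\<close>
  define d where "d = (Re s - 1) / 2"
  have d: "d > 0" using s by (simp add: d_def)
  have near: "\<bar>Re z - Re s\<bar> \<le> d" if "z \<in> cball s d" for z
    using that abs_Re_le_cmod[of "z - s"] by (simp add: dist_norm norm_minus_commute)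
  define K where "K = exp ((\<bar>Re s\<bar> + d) * \<bar>ln c\<bar>)"
  have bound: "norm (complex_of_real (\<alpha> j) powr (- z)) \<le> K * (real j + 1) powr (- (1 + d))"
    if "z \<in> cball s d" for j z
  proof -
    have zs: "Re s - d \<le> Re z" "Re z \<le> Re s + d" using near[OF that] by linarith+
    have "1 + d \<le> Re z" using zs by (simp add: d_def field_simps)
    hence "norm (complex_of_real (\<alpha> j) powr (- z)) \<le> c powr (- Re z) * (real j + 1) powr (- (1 + d))"
      using d by (intro powr_majorant) auto
    also have "c powr (- Re z) \<le> K"
    proof -
      have "- Re z * ln c \<le> \<bar>Re z\<bar> * \<bar>ln c\<bar>" by (metis abs_ge_self abs_minus_cancel abs_mult)
      also have "\<dots> \<le> (\<bar>Re s\<bar> + d) * \<bar>ln c\<bar>" using near[OF that] by (intro mult_right_mono) auto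
      finally show ?thesis using c_pos by (simp add: powr_def K_def)
    qed
    finally show ?thesis by (simp add: mult_right_mono)
  qed
  have "uniform_limit (cball s d) (\<lambda>n z. \<Sum>j<n. complex_of_real (\<alpha> j) powr (- z)) dirichlet sequentially"
    unfolding dirichlet_def
  proof (rule Weierstrass_m_test)
    show "summable (\<lambda>j. K * (real j + 1) powr (- (1 + d)))"
      using d by (intro summable_mult summable_shifted_powr) auto
  qed (use bound in auto)
  moreover have "cball s d \<subseteq> {s. Re s > 1}"
  proof
    fix z assume "z \<in> cball s d"
    hence "Re z \<ge> Re s - d" using near[of z] by linarith
    thus "z \<in> {s. Re s > 1}" using d by (simp add: d_def field_simps)
  qed
  ultimately show "\<exists>d>0. cball s d \<subseteq> {s. Re s > 1} \<and>
      uniform_limit (cball s d) (\<lambda>n z. \<Sum>j<n. complex_of_real (\<alpha> j) powr (- z)) dirichlet sequentially"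
    using d by blast
qed

text \<open>Termwise integration is justified by absolute convergence: the norms of the terms
  integrate to the same Gamma integrals at the real exponent \<open>Re s\<close>, and these are
  summable.\<close>

lemma mellin_heat:
  assumes "Re s > 1"
  shows "((\<lambda>x. complex_of_real x powr (s - 1) * of_real (heat x)) has_integral (Gamma s * dirichlet s)) {0<..}"
proof -
  define f where "f z j x = indicator {0<..} x *\<^sub>R (complex_of_real x powr (z - 1) * of_real (exp (- \<alpha> j * x)))"
    for z j x
  have hb: "has_bochner_integral lebesgue (f z j) (Gamma z * of_real (\<alpha> j) powr (- z))" if "Re z > 0" for z j
    unfolding f_def [abs_def] by (rule Gamma_integral_scaled) (use that \<alpha>_pos in auto)
  have nrm: "complex_of_real (norm (f s j x)) = f (of_real (Re s)) j x" for j x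
    by (cases "x > 0") (simp_all add: f_def norm_mult norm_of_real_powr powr_of_real[symmetric] del: powr_of_real)
  have intn: "(\<integral>x. norm (f s j x) \<partial>lebesgue) = norm (Gamma (complex_of_real (Re s)) * of_real (\<alpha> j) powr (- complex_of_real (Re s)))" for j
  proof -
    have "complex_of_real (\<integral>x. norm (f s j x) \<partial>lebesgue) = (\<integral>x. complex_of_real (norm (f s j x)) \<partial>lebesgue)"
      by simp
    also have "\<dots> = Gamma (of_real (Re s)) * of_real (\<alpha> j) powr (- of_real (Re s))"
      unfolding nrm using hb[of "of_real (Re s)" j] assms by (simp add: has_bochner_integral_iff)
    finally have "norm (complex_of_real (\<integral>x. norm (f s j x) \<partial>lebesgue)) =
       norm (Gamma (complex_of_real (Re s)) * of_real (\<alpha> j) powr (- complex_of_real (Re s)))" by simp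
    thus ?thesis by simp
  qed
  have int: "integrable lebesgue (f s j)" for j
    using hb[of s j] assms by (simp add: has_bochner_integral_iff)
  have sm1: "summable (\<lambda>j. norm (f s j x))" for x
  proof (cases "x > 0")
    case True
    have "norm (f s j x) = norm (complex_of_real x powr (s - 1)) * exp (- \<alpha> j * x)" for j
      using True by (simp add: f_def norm_mult)
    thus ?thesis using heat_geometric(1)[OF True] by (simp add: summable_mult)
  qed (simp add: f_def)
  have sm2: "summable (\<lambda>j. \<integral>x. norm (f s j x) \<partial>lebesgue)"
    unfolding intn norm_mult using assms by (intro summable_mult summable_dirichlet) simp
  have sumf: "(\<Sum>j. f s j x) = indicator {0<..} x *\<^sub>R (complex_of_real x powr (s - 1) * of_real (heat x))" for x
  proof (cases "x > 0")
    case True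
    have "(\<lambda>j. complex_of_real (exp (- \<alpha> j * x))) sums of_real (heat x)"
      unfolding heat_def using heat_geometric(1)[OF True] by (intro sums_of_real summable_sums)
    hence "(\<lambda>j. complex_of_real x powr (s - 1) * complex_of_real (exp (- \<alpha> j * x))) sums
        (complex_of_real x powr (s - 1) * of_real (heat x))" by (rule sums_mult)
    thus ?thesis using True by (simp add: f_def sums_iff)
  qed (simp add: f_def)
  have "integrable lebesgue (\<lambda>x. \<Sum>j. f s j x)"
    by (rule integrable_suminf) (use int sm1 sm2 in auto)
  hence si: "set_integrable lebesgue {0<..} (\<lambda>x. complex_of_real x powr (s - 1) * of_real (heat x))"
    unfolding sumf set_integrable_def .
  have "(\<integral>x. (\<Sum>j. f s j x) \<partial>lebesgue) = (\<Sum>j. integral\<^sup>L lebesgue (f s j))"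
    by (rule integral_suminf) (use int sm1 sm2 in auto)
  also have "\<dots> = (\<Sum>j. Gamma s * of_real (\<alpha> j) powr (- s))"
    using hb[of s] assms by (simp add: has_bochner_integral_iff)
  also have "\<dots> = Gamma s * dirichlet s"
    unfolding dirichlet_def using summable_norm_cancel[OF summable_dirichlet[OF assms]] by (rule suminf_mult)
  finally show ?thesis
    using has_integral_set_lebesgue[OF si] by (simp add: sumf set_lebesgue_integral_def)
qed

end

section \<open>The Hankel contour\<close>

text \<open>In terms of Taylor coefficients \<open>L\<close> has \<open>c n / (s + n - 1)\<close> where \<open>K\<close> has \<open>c n\<close>, so
  \<open>w powr (s - 1) * L w\<close> is a primitive of \<open>w powr (s - 1) * (K w / w)\<close> for every branch.\<close>
lemma euler_equation_solution:
  fixes K :: "complex \<Rightarrow> complex"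
  assumes hol: "K holomorphic_on ball 0 r" and s: "Re s > 1"
  obtains L L' where "\<And>w. w \<in> ball 0 r \<Longrightarrow> (L has_field_derivative L' w) (at w)"
    "\<And>w. w \<in> ball 0 r \<Longrightarrow> w * L' w + (s - 1) * L w = K w"
proof -
  define k where "k n = (deriv ^^ n) K 0 / fact n" for n
  define l where "l n = k n / (s + of_nat n - 1)" for n
  have K: "(\<lambda>n. k n * w ^ n) sums K w" if "w \<in> ball 0 r" for w
    using holomorphic_power_series[OF hol that] by (simp add: k_def)
  have den: "s + of_nat n - 1 \<noteq> 0" for n
  proof
    assume "s + of_nat n - 1 = 0"
    hence "Re (s + of_nat n - 1) = 0" by simp
    thus False using s by simp
  qed
  have abs_sm: "summable (\<lambda>n. norm (k n * w ^ n))" if "norm w < r" for w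
  proof -
    define R where "R = (norm w + r) / 2"
    have R: "norm w < R" "R < r" using that by (auto simp: R_def)
    have "R > 0" using R(1) norm_ge_zero[of w] by linarith
    have "summable (\<lambda>n. k n * of_real R ^ n)"
      using K[of "of_real R"] R \<open>R > 0\<close> by (simp add: sums_iff)
    thus ?thesis by (rule powser_insidea) (use R \<open>R > 0\<close> in simp)
  qed
  have l_sm: "summable (\<lambda>n. l n * w ^ n)" if "norm w < r" for w
  proof (rule summable_norm_cancel, rule summable_comparison_test')
    show "summable (\<lambda>n. inverse (Re s - 1) * norm (k n * w ^ n))"
      by (intro summable_mult abs_sm that)
    fix n
    \<comment> \<open>The denominators stay at distance at least \<open>Re s - 1\<close> from 0, so
      the series of \<open>L\<close> converges wherever that of \<open>K\<close> does.\<close>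
    have "Re s - 1 \<le> Re (s + of_nat n - 1)" by simp
    also have "\<dots> \<le> norm (s + of_nat n - 1)" by (rule complex_Re_le_cmod)
    finally have "inverse (norm (s + of_nat n - 1)) \<le> inverse (Re s - 1)"
      using s by (intro le_imp_inverse_le) auto
    hence "inverse (norm (s + of_nat n - 1)) * norm (k n * w ^ n) \<le> inverse (Re s - 1) * norm (k n * w ^ n)"
      by (intro mult_right_mono) auto
    thus "norm (norm (l n * w ^ n)) \<le> inverse (Re s - 1) * norm (k n * w ^ n)"
      by (simp add: l_def norm_mult norm_inverse divide_inverse mult_ac)
  qed
  define L where "L w = (\<Sum>n. l n * w ^ n)" for w
  define L' where "L' w = (\<Sum>n. diffs l n * w ^ n)" for w
  have der: "(L has_field_derivative L' w) (at w)" if "w \<in> ball 0 r" for w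
    unfolding L_def L'_def by (rule termdiffs_strong'[of r]) (use l_sm that in auto)
  moreover have "w * L' w + (s - 1) * L w = K w" if w: "w \<in> ball 0 r" for w
  proof -
    have "summable (\<lambda>n. diffs l n * w ^ n)"
      by (rule termdiff_converges[of _ r]) (use l_sm w in auto)
    hence "(\<lambda>n. w * (diffs l n * w ^ n)) sums (w * L' w)"
      unfolding L'_def by (intro sums_mult summable_sums)
    hence "(\<lambda>n. of_nat (Suc n) * l (Suc n) * w ^ Suc n) sums (w * L' w)"
      by (simp add: diffs_def mult_ac)
    hence "(\<lambda>n. of_nat n * l n * w ^ n) sums (w * L' w)"
      by (subst (asm) sums_Suc_iff) simp
    moreover have "(\<lambda>n. (s - 1) * (l n * w ^ n)) sums ((s - 1) * L w)"
      unfolding L_def using l_sm w by (intro sums_mult summable_sums) auto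
    ultimately have "(\<lambda>n. of_nat n * l n * w ^ n + (s - 1) * (l n * w ^ n)) sums (w * L' w + (s - 1) * L w)"
      by (rule sums_add)
    also have "(\<lambda>n. of_nat n * l n * w ^ n + (s - 1) * (l n * w ^ n)) = (\<lambda>n. k n * w ^ n)"
    proof
      fix n
      have "of_nat n * l n * w ^ n + (s - 1) * (l n * w ^ n) = (s + of_nat n - 1) * l n * w ^ n"
        by (simp add: algebra_simps)
      also have "(s + of_nat n - 1) * l n = k n" using den[of n] by (simp add: l_def)
      finally show "of_nat n * l n * w ^ n + (s - 1) * (l n * w ^ n) = k n * w ^ n" .
    qed
    finally show ?thesis using K[OF w] sums_unique2 by blast
  qed
  ultimately show ?thesis using that by blast
qed

text \<open>\<open>K w\<close> is \<open>w * F w\<close> with the removable singularity at 0 filled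
  in, so that local arguments deal with a holomorphic function, while \<open>F\<close> itself has a
  simple pole at 0 unless \<open>K 0 = 0\<close>.\<close>

locale hankel_contour =
  fixes Om :: "complex \<Rightarrow> complex" and \<tau> \<rho> r c C :: real and K :: "complex \<Rightarrow> complex"
  assumes \<rho>: "0 < \<rho>" "\<rho> < r"
    and K_hol: "K holomorphic_on ball 0 r"
    and F_eq: "\<And>w. w \<in> ball 0 r \<Longrightarrow> w \<noteq> 0 \<Longrightarrow> hankel_F Om \<tau> w = K w / w"
    and F_cont: "continuous_on {\<rho>..} (\<lambda>x. hankel_F Om \<tau> (of_real x))"
    and F_bound: "\<And>x. x \<ge> \<rho> \<Longrightarrow> norm (hankel_F Om \<tau> (of_real x)) \<le> C * exp (- c * x)"
    and c: "c > 0"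
begin

abbreviation F :: "complex \<Rightarrow> complex" where "F \<equiv> hankel_F Om \<tau>"

text \<open>The factor common to both rays; they differ from it by phases independent of
  \<open>x\<close> (\<open>hankel_rays\<close>), so convergence and holomorphy are settled
  once.\<close>

definition ray :: "complex \<Rightarrow> real \<Rightarrow> complex" where
  "ray s x = exp ((s - 1) * of_real (ln x)) * F (of_real x)"

lemma ray_eq_powr: "x > 0 \<Longrightarrow> ray s x = of_real x powr (s - 1) * F (of_real x)"
  by (simp add: ray_def powr_def Ln_of_real)

text \<open>Half of the decay rate is given up to absorb the power of \<open>x\<close>. The bound
  ignores \<open>Im s\<close>, because \<open>ln x\<close> is real, and is uniform for
  \<open>Re s\<close> in a bounded range, as holomorphy in \<open>s\<close> requires.\<close>

lemma ray_bound:
  assumes "M \<ge> 0"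
  obtains B where "B \<ge> 0" "\<And>s x. \<bar>Re s - 1\<bar> \<le> M \<Longrightarrow> x \<ge> \<rho> \<Longrightarrow> norm (ray s x) \<le> B * exp (- (c / 2) * x)"
proof -
  \<comment> \<open>Made for \<open>ln y \<le> y - 1\<close> at \<open>y = e * x\<close>: the
    exponent \<open>M * e * x\<close> must stay within \<open>c / 2 * x\<close>. The
    \<open>+ 1\<close> covers \<open>M = 0\<close>.\<close>
  define e where "e = c / (2 * (M + 1))"
  have e: "e > 0" "M * e \<le> c / 2" using c assms by (auto simp: e_def field_simps)
  define D where "D = \<bar>ln e\<bar> + \<bar>ln \<rho>\<bar>"
  have C: "C \<ge> 0"
  proof -
    have "0 \<le> C * exp (- c * \<rho>)" using F_bound[of \<rho>] norm_ge_zero order_trans by blast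
    thus ?thesis by (simp add: zero_le_mult_iff)
  qed
  have "norm (ray s x) \<le> (exp (M * D) * C) * exp (- (c / 2) * x)" if "\<bar>Re s - 1\<bar> \<le> M" "x \<ge> \<rho>" for s x
  proof -
    have x: "x > 0" using that \<rho> by simp
    have "ln (e * x) \<le> e * x - 1" using e x by (intro ln_le_minus_one) auto
    hence "ln x \<le> e * x + D" using e x by (simp add: ln_mult D_def)
    moreover have "ln \<rho> \<le> ln x" using that \<rho> by simp
    hence "- ln x \<le> e * x + D" using e x by (simp add: D_def add_increasing)
    ultimately have lnx: "\<bar>ln x\<bar> \<le> e * x + D" by linarith
    have "(Re s - 1) * ln x \<le> \<bar>Re s - 1\<bar> * \<bar>ln x\<bar>" by (metis abs_ge_self abs_mult)
    also have "\<dots> \<le> M * (e * x + D)" using that lnx by (intro mult_mono) auto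
    also have "\<dots> \<le> c / 2 * x + M * D" using mult_right_mono[OF e(2), of x] x by (simp add: algebra_simps)
    finally have "norm (exp ((s - 1) * of_real (ln x))) \<le> exp (c / 2 * x + M * D)" by simp
    hence "norm (ray s x) \<le> exp (c / 2 * x + M * D) * (C * exp (- c * x))"
      unfolding ray_def norm_mult using F_bound[OF that(2)] by (intro mult_mono) auto
    also have "\<dots> = (exp (M * D) * C) * (exp (c / 2 * x) * exp (- c * x))" by (simp add: exp_add)
    also have "exp (c / 2 * x) * exp (- c * x) = exp (- (c / 2) * x)" by (simp flip: exp_add)
    finally show ?thesis .
  qed
  thus ?thesis using that[of "exp (M * D) * C"] C by simp
qed

lemma ray_continuous: "continuous_on {\<rho>..} (ray s)"
  unfolding ray_def using \<rho> by (intro continuous_intros F_cont) auto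

lemma ray_integrable:
  assumes "a \<ge> \<rho>"
  shows "ray s integrable_on {a..}"
proof -
  obtain B where B: "B \<ge> 0" "\<And>s' x. \<bar>Re s' - 1\<bar> \<le> \<bar>Re s - 1\<bar> \<Longrightarrow> x \<ge> \<rho> \<Longrightarrow> norm (ray s' x) \<le> B * exp (- (c / 2) * x)"
    using ray_bound[of "\<bar>Re s - 1\<bar>"] by auto
  show ?thesis
  proof (rule measurable_bounded_by_integrable_imp_integrable)
    show "ray s \<in> borel_measurable (lebesgue_on {a..})"
      by (intro continuous_imp_measurable_on_sets_lebesgue continuous_on_subset[OF ray_continuous])
        (use assms in auto)
    show "(\<lambda>x. B * exp (- (c / 2) * x)) integrable_on {a..}"
      using integrable_on_exp_minus_to_infinity[of "c / 2" a] c by (intro integrable_on_mult_right) auto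
    show "norm (ray s x) \<le> B * exp (- (c / 2) * x)" if "x \<in> {a..}" for x
      using B(2)[of s x] that assms by auto
  qed auto
qed

definition ray_integral :: "complex \<Rightarrow> complex" where "ray_integral s = integral {\<rho>..} (ray s)"

lemma has_integral_ray: "(ray s has_integral ray_integral s) {\<rho>..}"
  unfolding ray_integral_def using ray_integrable by (intro integrable_integral) auto

lemma ray_tail:
  assumes "\<And>x. x \<ge> \<rho> \<Longrightarrow> norm (ray s x) \<le> B * exp (- (c / 2) * x)" "a \<ge> \<rho>"
  shows "norm (integral {\<rho>..a} (ray s) - ray_integral s) \<le> B * (exp (- (c / 2) * a) / (c / 2))"
proof -
  have 1: "(ray s has_integral integral {\<rho>..a} (ray s)) {\<rho>..a}"
    by (intro integrable_integral integrable_continuous_interval continuous_on_subset[OF ray_continuous]) auto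
  have 2: "(ray s has_integral integral {a..} (ray s)) {a..}"
    by (intro integrable_integral ray_integrable assms)
  have "{\<rho>..a} \<inter> {a..} = {a}" "{\<rho>..a} \<union> {a..} = {\<rho>..}" using assms(2) by auto
  hence "(ray s has_integral (integral {\<rho>..a} (ray s) + integral {a..} (ray s))) {\<rho>..}"
    using has_integral_Un[OF 1 2] by simp
  hence "ray_integral s = integral {\<rho>..a} (ray s) + integral {a..} (ray s)"
    unfolding ray_integral_def by (rule integral_unique)
  hence "norm (integral {\<rho>..a} (ray s) - ray_integral s) = norm (integral {a..} (ray s))" by simp
  also have "\<dots> \<le> integral {a..} (\<lambda>x. B * exp (- (c / 2) * x))"
  proof (rule integral_norm_bound_integral)
    show "ray s integrable_on {a..}" by (intro ray_integrable assms)
    show "(\<lambda>x. B * exp (- (c / 2) * x)) integrable_on {a..}"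
      using integrable_on_exp_minus_to_infinity[of "c / 2" a] c by (intro integrable_on_mult_right) auto
  qed (use assms in auto)
  also have "\<dots> = B * (exp (- (c / 2) * a) / (c / 2))"
    using has_integral_mult_right[OF has_integral_exp_minus_to_infinity[of "c / 2" a], of B] c
    by (intro integral_unique) auto
  finally show ?thesis .
qed

text \<open>Truncated integrals are holomorphic by differentiation under the integral sign, and
  \<open>ray_tail\<close>, with a constant uniform on the unit disc around \<open>s\<close>, makes
  them converge locally uniformly.\<close>

lemma holomorphic_ray_integral: "ray_integral holomorphic_on UNIV"
proof (rule holomorphic_uniform_sequence)
  fix n :: nat
  have "(\<lambda>s. integral (cbox \<rho> (\<rho> + real n)) (ray s)) holomorphic_on UNIV"
  proof (rule leibniz_rule_holomorphic)
    show "((\<lambda>s. ray s x) has_field_derivative (of_real (ln x) * ray s x)) (at s within UNIV)" for s x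
      unfolding ray_def by (auto intro!: derivative_eq_intros)
    show "ray s integrable_on cbox \<rho> (\<rho> + real n)" for s
      by (intro integrable_continuous continuous_on_subset[OF ray_continuous]) auto
    have "continuous_on (UNIV \<times> cbox \<rho> (\<rho> + real n)) (\<lambda>p. F (of_real (snd p)))"
      by (rule continuous_on_compose2[OF F_cont continuous_on_snd[OF continuous_on_id]]) auto
    thus "continuous_on (UNIV \<times> cbox \<rho> (\<rho> + real n)) (\<lambda>(s, x). of_real (ln x) * ray s x)"
      unfolding ray_def case_prod_beta using \<rho> by (intro continuous_intros) auto
  qed auto
  thus "(\<lambda>s. integral {\<rho>..\<rho> + real n} (ray s)) holomorphic_on UNIV" by simp
next
  fix s :: complex
  obtain B where B: "B \<ge> 0" "\<And>z x. \<bar>Re z - 1\<bar> \<le> \<bar>Re s - 1\<bar> + 1 \<Longrightarrow> x \<ge> \<rho> \<Longrightarrow> norm (ray z x) \<le> B * exp (- (c / 2) * x)"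
    using ray_bound[of "\<bar>Re s - 1\<bar> + 1"] by auto
  have "uniform_limit (cball s 1) (\<lambda>n z. integral {\<rho>..\<rho> + real n} (ray z)) ray_integral sequentially"
  proof (rule uniform_limitI)
    fix e :: real assume e: "e > 0"
    have "((\<lambda>n. B * (exp (- (c / 2) * (\<rho> + real n)) / (c / 2))) \<longlonglongrightarrow> 0)"
      using c by real_asymp
    from order_tendstoD(2)[OF this e]
    show "\<forall>\<^sub>F n in sequentially. \<forall>z\<in>cball s 1. dist (integral {\<rho>..\<rho> + real n} (ray z)) (ray_integral z) < e"
    proof eventually_elim
      case (elim n)
      show ?case
      proof
        fix z assume "z \<in> cball s 1"
        hence "\<bar>Re z - Re s\<bar> \<le> 1"
          using abs_Re_le_cmod[of "z - s"] by (simp add: dist_norm norm_minus_commute)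
        hence "\<bar>Re z - 1\<bar> \<le> \<bar>Re s - 1\<bar> + 1" by linarith
        from ray_tail[OF B(2)[OF this], of "\<rho> + real n"] elim
        show "dist (integral {\<rho>..\<rho> + real n} (ray z)) (ray_integral z) < e" by (simp add: dist_norm)
      qed
    qed
  qed
  thus "\<exists>d>0. cball s d \<subseteq> UNIV \<and> uniform_limit (cball s d) (\<lambda>n z. integral {\<rho>..\<rho> + real n} (ray z)) ray_integral sequentially"
    by (intro exI[of _ 1]) auto
qed auto

text \<open>\<open>(-w)\<close> to the power \<open>s - 1\<close> continued along the circle, with
  \<open>arg (-w)\<close> running from \<open>-pi\<close> to \<open>pi\<close>. Unlike the principal
  \<open>powr\<close> it is continuous at \<open>t = 0\<close>, where \<open>powr\<close> takes the
  value from the other side of the cut.\<close>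

definition phase :: "complex \<Rightarrow> real \<Rightarrow> complex" where
  "phase s t = exp ((s - 1) * (of_real (ln \<rho>) + \<i> * of_real (pi * (2 * t - 1))))"

definition circle_integral :: "complex \<Rightarrow> complex" where
  "circle_integral s = integral {0..1} (\<lambda>t. phase s t * (2 * of_real pi * \<i> * K (circlepath 0 \<rho> t)))"

lemma circlepath_in_ball: "circlepath 0 \<rho> t \<in> ball 0 r" "circlepath 0 \<rho> t \<noteq> 0"
  using \<rho> by (auto simp: circlepath norm_mult)

lemma continuous_K_circle: "continuous_on A (\<lambda>t. K (circlepath 0 \<rho> t))"
proof (rule continuous_on_compose2[OF holomorphic_on_imp_continuous_on[OF K_hol]])
  show "continuous_on A (circlepath 0 \<rho>)" unfolding circlepath by (intro continuous_intros)
qed (use circlepath_in_ball in auto)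

lemma powr_on_circle:
  assumes "0 < t" "t < 1"
  shows "(- circlepath 0 \<rho> t) powr (s - 1) = phase s t"
proof -
  define z where "z = complex_of_real (ln \<rho>) + \<i> * of_real (pi * (2 * t - 1))"
  have "exp z = of_real \<rho> * exp (\<i> * of_real (pi * (2 * t - 1)))"
    using \<rho> by (simp add: z_def exp_add exp_of_real)
  also have "\<i> * of_real (pi * (2 * t - 1)) = 2 * of_real pi * \<i> * of_real t - \<i> * of_real pi"
    by (simp add: algebra_simps)
  also have "of_real \<rho> * exp \<dots> = - circlepath 0 \<rho> t"
    by (simp add: circlepath exp_diff exp_pi_i')
  finally have ez: "exp z = - circlepath 0 \<rho> t" .
  have "Ln (- circlepath 0 \<rho> t) = z"
    unfolding ez[symmetric]
  proof (rule Ln_exp)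
    have "pi * (2 * t - 1) > pi * (- 1)" "pi * (2 * t - 1) < pi * 1" using assms pi_gt_zero
      by (intro mult_strict_left_mono; simp)+
    thus "- pi < Im z" "Im z \<le> pi" by (simp_all add: z_def)
  qed
  thus ?thesis using circlepath_in_ball(2)[of t] by (simp add: powr_def phase_def z_def)
qed

lemma continuous_circle_integrand:
  "continuous_on A (\<lambda>t. phase s t * (2 * of_real pi * \<i> * K (circlepath 0 \<rho> t)))"
  unfolding phase_def by (intro continuous_intros continuous_K_circle)

lemma has_contour_integral_circle:
  "((\<lambda>w. (- w) powr (s - 1) * F w) has_contour_integral circle_integral s) (circlepath 0 \<rho>)"
  unfolding has_contour_integral_def
\<comment> \<open>At \<open>t = 0\<close> the principal \<open>powr\<close> uses the argument
  \<open>pi\<close> instead of \<open>-pi\<close>; the endpoints form a null set.\<close>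
proof (rule has_integral_spike_finite[of "{0, 1}"])
  show "((\<lambda>t. phase s t * (2 * of_real pi * \<i> * K (circlepath 0 \<rho> t))) has_integral circle_integral s) {0..1}"
    unfolding circle_integral_def
    by (intro integrable_integral integrable_continuous_interval continuous_circle_integrand)
  fix t :: real assume t: "t \<in> {0..1} - {0, 1}"
  have "F (circlepath 0 \<rho> t) = K (circlepath 0 \<rho> t) / circlepath 0 \<rho> t"
    by (rule F_eq) (use circlepath_in_ball in auto)
  moreover have "vector_derivative (circlepath 0 \<rho>) (at t within {0..1}) = 2 * of_real pi * \<i> * circlepath 0 \<rho> t"
    using t by (subst vector_derivative_circlepath01) (auto simp: circlepath)
  ultimately show "(- circlepath 0 \<rho> t) powr (s - 1) * F (circlepath 0 \<rho> t) *
      vector_derivative (circlepath 0 \<rho>) (at t within {0..1}) =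
      phase s t * (2 * of_real pi * \<i> * K (circlepath 0 \<rho> t))"
    using t powr_on_circle[of t s] circlepath_in_ball(2)[of t] by simp
qed simp

lemma holomorphic_circle_integral: "circle_integral holomorphic_on UNIV"
proof -
  have "(\<lambda>s. integral (cbox 0 1) (\<lambda>t. phase s t * (2 * of_real pi * \<i> * K (circlepath 0 \<rho> t)))) holomorphic_on UNIV"
  proof (rule leibniz_rule_holomorphic)
    show "((\<lambda>s. phase s t * (2 * of_real pi * \<i> * K (circlepath 0 \<rho> t))) has_field_derivative
        ((of_real (ln \<rho>) + \<i> * of_real (pi * (2 * t - 1))) * phase s t * (2 * of_real pi * \<i> * K (circlepath 0 \<rho> t))))
        (at s within UNIV)" for s t
      unfolding phase_def by (auto intro!: derivative_eq_intros)
    show "(\<lambda>t. phase s t * (2 * of_real pi * \<i> * K (circlepath 0 \<rho> t))) integrable_on cbox 0 1" for s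
      by (intro integrable_continuous continuous_circle_integrand)
    have "continuous_on (UNIV \<times> cbox 0 1) (\<lambda>p::complex \<times> real. K (circlepath 0 \<rho> (snd p)))"
      by (rule continuous_on_compose2[OF continuous_K_circle[of UNIV] continuous_on_snd[OF continuous_on_id]]) auto
    thus "continuous_on (UNIV \<times> cbox 0 1) (\<lambda>(s, t). (of_real (ln \<rho>) + \<i> * of_real (pi * (2 * t - 1))) * phase s t
        * (2 * of_real pi * \<i> * K (circlepath 0 \<rho> t)))"
      unfolding phase_def case_prod_beta by (intro continuous_intros)
  qed auto
  thus ?thesis by (simp add: circle_integral_def [abs_def])
qed

section \<open>The full contour: holomorphy in \<open>s\<close> and collapse onto the axis\<close>

lemma hankel_rays:
  "(hankel_in Om \<tau> s has_integral exp (- ((s - 1) * (\<i> * of_real pi))) * ray_integral s) {\<rho>..}"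
  "(hankel_out Om \<tau> s has_integral exp ((s - 1) * (\<i> * of_real pi)) * ray_integral s) {\<rho>..}"
proof -
  have eq: "hankel_in Om \<tau> s x = exp (- ((s - 1) * (\<i> * of_real pi))) * ray s x"
    "hankel_out Om \<tau> s x = exp ((s - 1) * (\<i> * of_real pi)) * ray s x" if "x \<in> {\<rho>..}" for x
  proof -
    have "Ln (of_real x) = of_real (ln x)" using that \<rho> by (intro Ln_of_real) auto
    thus "hankel_in Om \<tau> s x = exp (- ((s - 1) * (\<i> * of_real pi))) * ray s x"
      "hankel_out Om \<tau> s x = exp ((s - 1) * (\<i> * of_real pi)) * ray s x"
      by (simp_all add: hankel_in_def hankel_out_def ray_def ring_distribs exp_add exp_diff exp_minus field_simps)
  qed
  show "(hankel_in Om \<tau> s has_integral exp (- ((s - 1) * (\<i> * of_real pi))) * ray_integral s) {\<rho>..}"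
    by (rule has_integral_eq[OF _ has_integral_mult_right[OF has_integral_ray]]) (use eq in auto)
  show "(hankel_out Om \<tau> s has_integral exp ((s - 1) * (\<i> * of_real pi)) * ray_integral s) {\<rho>..}"
    by (rule has_integral_eq[OF _ has_integral_mult_right[OF has_integral_ray]]) (use eq in auto)
qed

definition branch_jump :: "complex \<Rightarrow> complex" where
  "branch_jump s = exp ((s - 1) * (\<i> * of_real pi)) - exp (- ((s - 1) * (\<i> * of_real pi)))"

lemma hankel_integral_eq: "hankel_integral Om \<tau> \<rho> s = branch_jump s * ray_integral s + circle_integral s"
proof -
  have "contour_integral (circlepath 0 \<rho>) (\<lambda>w. (- w) powr (s - 1) * F w) = circle_integral s"
    using has_contour_integral_circle by (rule contour_integral_unique)
  thus ?thesis unfolding hankel_integral_def branch_jump_def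
    using integral_unique[OF hankel_rays(1)[of s]] integral_unique[OF hankel_rays(2)[of s]]
    by (simp add: algebra_simps)
qed

lemma holomorphic_hankel_integral: "hankel_integral Om \<tau> \<rho> holomorphic_on UNIV"
  unfolding hankel_integral_eq [abs_def] branch_jump_def
  by (intro holomorphic_intros holomorphic_ray_integral holomorphic_circle_integral)

lemma branch_jump_eq_sin: "branch_jump s = - (2 * \<i> * sin (of_real pi * s))"
proof -
  have "exp (\<i> * (of_real pi * s)) = exp ((s - 1) * (\<i> * of_real pi) + \<i> * of_real pi)"
    by (simp only: algebra_simps) simp
  hence 1: "exp ((s - 1) * (\<i> * of_real pi)) = - exp (\<i> * (of_real pi * s))" by (simp only: exp_add) simp
  have "exp (- (\<i> * (of_real pi * s))) = exp (- ((s - 1) * (\<i> * of_real pi)) - \<i> * of_real pi)"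
    by (simp only: algebra_simps) simp
  hence 2: "exp (- ((s - 1) * (\<i> * of_real pi))) = - exp (- (\<i> * (of_real pi * s)))"
    by (simp only: exp_diff) simp
  show ?thesis unfolding branch_jump_def 1 2 sin_exp_eq by (simp add: field_simps)
qed

text \<open>The primitive \<open>w powr (s - 1) * L w\<close> changes by its value at
  \<open>\<rho>\<close> along the segment from 0, and by \<open>branch_jump s\<close> times that
  value around the circle, because \<open>L\<close> is single-valued and only the phase has turned.
  So the circle contributes exactly the jump times the missing piece of the axis.\<close>

lemma hankel_integral_collapse:
  assumes s: "Re s > 1"
    and M: "((\<lambda>x. of_real x powr (s - 1) * F (of_real x)) has_integral M) {0<..}"
  shows "hankel_integral Om \<tau> \<rho> s = branch_jump s * M"
proof -
  obtain L L' where L: "\<And>w. w \<in> ball 0 r \<Longrightarrow> (L has_field_derivative L' w) (at w)"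
    and LK: "\<And>w. w \<in> ball 0 r \<Longrightarrow> w * L' w + (s - 1) * L w = K w"
    using euler_equation_solution[OF K_hol s] by metis
  have L_cont: "continuous_on (ball 0 r) L"
    using L by (meson DERIV_isCont continuous_at_imp_continuous_on)

  define \<Phi> where "\<Phi> x = of_real x powr (s - 1) * L (of_real x)" for x :: real
  have "((\<lambda>x. of_real x powr (s - 1) * F (of_real x)) has_integral (\<Phi> \<rho> - \<Phi> 0)) {0..\<rho>}"
  proof (rule fundamental_theorem_of_calculus_interior)
    show "0 \<le> \<rho>" using \<rho> by simp
    \<comment> \<open>\<open>Re s > 1\<close> gives continuity up to 0, where \<open>\<Phi>\<close>
      vanishes since \<open>0 powr z = 0\<close>; differentiability is then needed only in the
      interior.\<close>
    have "continuous_on {0..\<rho>} (\<lambda>x. complex_of_real x powr (s - 1))"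
    proof (rule continuous_on_powr_complex)
      show "{0..\<rho>} \<subseteq> {x. Re (complex_of_real x) \<ge> 0 \<or> Im (complex_of_real x) \<noteq> 0}" by auto
    qed (use s in \<open>auto intro!: continuous_intros\<close>)
    moreover have "continuous_on {0..\<rho>} (\<lambda>x. L (complex_of_real x))"
      by (rule continuous_on_compose2[OF L_cont]) (use \<rho> in \<open>auto intro!: continuous_intros\<close>)
    ultimately show "continuous_on {0..\<rho>} \<Phi>" unfolding \<Phi>_def by (rule continuous_on_mult)
    fix x assume "x \<in> {0<..<\<rho>}"
    hence x: "x > 0" "complex_of_real x \<in> ball 0 r" using \<rho> by auto
    have "((\<lambda>w. w powr (s - 1) * L w) has_field_derivative
        ((s - 1) * of_real x powr (s - 1 - 1) * L (of_real x) + L' (of_real x) * of_real x powr (s - 1))) (at (of_real x))"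
      using x(1) by (intro DERIV_mult has_field_derivative_powr L x(2)) auto
    also have "(s - 1) * of_real x powr (s - 1 - 1) * L (of_real x) + L' (of_real x) * of_real x powr (s - 1)
        = of_real x powr (s - 1) * ((of_real x * L' (of_real x) + (s - 1) * L (of_real x)) / of_real x)"
      using x(1) by (simp add: powr_diff field_simps power2_eq_square)
    also have "\<dots> = of_real x powr (s - 1) * F (of_real x)"
      using x by (simp add: LK F_eq)
    finally show "(\<Phi> has_vector_derivative of_real x powr (s - 1) * F (of_real x)) (at x)"
      unfolding \<Phi>_def by (rule has_vector_derivative_real_field)
  qed
  hence low: "((\<lambda>x. of_real x powr (s - 1) * F (of_real x)) has_integral \<Phi> \<rho>) {0..\<rho>}"
    by (simp add: \<Phi>_def)
  have high: "((\<lambda>x. of_real x powr (s - 1) * F (of_real x)) has_integral ray_integral s) {\<rho>..}"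
    by (rule has_integral_eq[OF _ has_integral_ray]) (use \<rho> ray_eq_powr in auto)
  have "{0..\<rho>} \<inter> {\<rho>..} = {\<rho>}" "{0..\<rho>} \<union> {\<rho>..} = {0..}" using \<rho> by auto
  hence "((\<lambda>x. of_real x powr (s - 1) * F (of_real x)) has_integral (\<Phi> \<rho> + ray_integral s)) {0..}"
    using has_integral_Un[OF low high] by simp
  moreover have "((\<lambda>x. of_real x powr (s - 1) * F (of_real x)) has_integral M) {0..}"
  proof (rule iffD1[OF has_integral_spike_set_eq M])
    show "negligible {x \<in> {0<..} - {0..}. of_real x powr (s - 1) * F (of_real x) \<noteq> 0}"
      by (rule negligible_subset[of "{}"]) auto
    show "negligible {x \<in> {0..} - {0<..}. of_real x powr (s - 1) * F (of_real x) \<noteq> 0}"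
      by (rule negligible_subset[of "{0}"]) auto
  qed
  ultimately have M_eq: "M = \<Phi> \<rho> + ray_integral s" by (rule has_integral_unique[OF _ _, symmetric])

  define \<Psi> where "\<Psi> t = phase s t * L (circlepath 0 \<rho> t)" for t
  have "((\<lambda>t. phase s t * (2 * of_real pi * \<i> * K (circlepath 0 \<rho> t))) has_integral (\<Psi> 1 - \<Psi> 0)) {0..1}"
  proof (rule fundamental_theorem_of_calculus)
    fix t :: real
    have p: "(phase s has_vector_derivative phase s t * ((s - 1) * (2 * of_real pi * \<i>))) (at t)"
    proof -
      define f where "f z = exp ((s - 1) * (of_real (ln \<rho>) + \<i> * (of_real pi * (2 * z - 1))))" for z
      have f: "f (of_real t) = phase s t" for t by (simp add: f_def phase_def)
      have "(f has_field_derivative f z * ((s - 1) * (2 * of_real pi * \<i>))) (at z)" for z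
        unfolding f_def by (rule derivative_eq_intros refl | simp)+
      from has_vector_derivative_real_field[OF this] show ?thesis by (simp add: f)
    qed
    have "(circlepath 0 \<rho> has_vector_derivative 2 * of_real pi * \<i> * circlepath 0 \<rho> t) (at t)"
      using has_vector_derivative_circlepath[of 0 \<rho> t UNIV] by (simp add: circlepath mult_ac)
    hence "((L \<circ> circlepath 0 \<rho>) has_vector_derivative (2 * of_real pi * \<i> * circlepath 0 \<rho> t * L' (circlepath 0 \<rho> t))) (at t)"
      by (rule field_vector_diff_chain_at) (rule L[OF circlepath_in_ball(1)])
    hence "((\<lambda>t. L (circlepath 0 \<rho> t)) has_vector_derivative (2 * of_real pi * \<i> * circlepath 0 \<rho> t * L' (circlepath 0 \<rho> t))) (at t)"
      by (simp add: o_def)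
    from has_vector_derivative_mult[OF p this]
    have "(\<Psi> has_vector_derivative phase s t * (2 * of_real pi * \<i> *
        (circlepath 0 \<rho> t * L' (circlepath 0 \<rho> t) + (s - 1) * L (circlepath 0 \<rho> t)))) (at t)"
      unfolding \<Psi>_def by (simp add: algebra_simps)
    thus "(\<Psi> has_vector_derivative phase s t * (2 * of_real pi * \<i> * K (circlepath 0 \<rho> t))) (at t within {0..1})"
      unfolding LK[OF circlepath_in_ball(1)] by (rule has_vector_derivative_at_within)
  qed simp
  hence "circle_integral s = \<Psi> 1 - \<Psi> 0" unfolding circle_integral_def by (rule integral_unique)
  also have "\<dots> = branch_jump s * \<Phi> \<rho>"
    using \<rho> by (simp add: \<Psi>_def \<Phi>_def phase_def branch_jump_def circlepath powr_def Ln_of_real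
        distrib_left exp_add exp_diff exp_minus algebra_simps)
  finally show ?thesis by (simp add: hankel_integral_eq M_eq algebra_simps)
qed

lemma hankel_integral_1: "hankel_integral Om \<tau> \<rho> 1 = 2 * of_real pi * \<i> * K 0"
proof -
  have "((\<lambda>w. K w / (w - 0)) has_contour_integral 2 * of_real pi * \<i> * K 0) (circlepath 0 \<rho>)"
    by (rule Cauchy_integral_circlepath_simple)
      (use \<rho> K_hol in \<open>auto intro: holomorphic_on_subset\<close>)
  moreover have "(- w) powr (1 - 1) * F w = K w / (w - 0)" if "w \<in> path_image (circlepath 0 \<rho>)" for w
    using that \<rho> F_eq[of w] by (auto simp: path_image_circlepath)
  ultimately have "((\<lambda>w. (- w) powr (1 - 1) * F w) has_contour_integral 2 * of_real pi * \<i> * K 0) (circlepath 0 \<rho>)"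
    by (metis (no_types, lifting) has_contour_integral_eq)
  hence "circle_integral 1 = 2 * of_real pi * \<i> * K 0"
    using has_contour_integral_circle[of 1] by (metis has_contour_integral_unique)
  thus ?thesis by (simp add: hankel_integral_eq branch_jump_def)
qed

end

section \<open>Meromorphic continuation\<close>

text \<open>The zeros are the multiples of \<open>2 * pi * \<i>\<close>: the half-plane contains
  none of them, the disc only 0.\<close>

lemma one_minus_exp_nonzero:
  assumes "w \<in> {t. Re t > 0} \<union> ball 0 pi" "w \<noteq> 0"
  shows "1 - exp (- w) \<noteq> (0 :: complex)"
proof
  assume "1 - exp (- w) = 0"
  hence "exp (- w) = 1" by simp
  then obtain n :: int where n: "Re w = 0" "- Im w = of_int (2 * n) * pi"
    by (auto simp: exp_eq_1)
  have "norm w < pi" using assms(1) n(1) by auto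
  hence "\<bar>Im w\<bar> < pi" using abs_Im_le_cmod[of w] by linarith
  hence "\<bar>of_int (2 * n) * pi\<bar> < 1 * pi" unfolding n(2)[symmetric] by simp
  hence "\<bar>of_int (2 * n)\<bar> < (1 :: real)" unfolding abs_mult by (simp del: of_int_mult)
  hence "n = 0" by linarith
  hence "w = 0" using n by (simp add: complex_eq_iff)
  thus False using assms(2) by simp
qed

lemma todd_holomorphic:
  "(\<lambda>w. if w = 0 then 1 else w / (1 - exp (- w))) holomorphic_on ball (0 :: complex) pi"
proof -
  define p where "p w = (if w = 0 then 1 else (1 - exp (- w)) / w)" for w :: complex
  have "p holomorphic_on ball 0 pi"
  proof (rule pole_theorem_open_0[where g = "\<lambda>w. 1 - exp (- w)" and a = 0])
    have "((\<lambda>w. 1 - exp (- w)) has_field_derivative 1) (at (0 :: complex))"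
      by (auto intro!: derivative_eq_intros)
    thus "p 0 = deriv (\<lambda>w. 1 - exp (- w)) 0" by (simp add: p_def DERIV_imp_deriv)
  qed (auto simp: p_def intro!: holomorphic_intros)
  moreover have "p w \<noteq> 0" if "w \<in> ball 0 pi" for w
    using one_minus_exp_nonzero[of w] that by (auto simp: p_def)
  ultimately have "(\<lambda>w. 1 / p w) holomorphic_on ball 0 pi" by (intro holomorphic_intros) auto
  also have "(\<lambda>w. 1 / p w) = (\<lambda>w. if w = 0 then 1 else w / (1 - exp (- w)))"
    by (auto simp: p_def)
  finally show ?thesis .
qed

lemma Gamma_one_minus_singular_iff:
  "1 - s \<in> \<int>\<^sub>\<le>\<^sub>0 \<longleftrightarrow> s \<in> {of_nat n | n. n \<ge> 1}" for s :: complex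
proof
  assume "1 - s \<in> \<int>\<^sub>\<le>\<^sub>0"
  then obtain n where "1 - s = - of_nat n" by (rule nonpos_Ints_cases')
  hence "s = of_nat (Suc n)" by (simp add: algebra_simps)
  thus "s \<in> {of_nat n | n. n \<ge> 1}" by (intro CollectI exI[of _ "Suc n"]) auto
next
  assume "s \<in> {of_nat n | n. n \<ge> 1}"
  then obtain n where n: "s = of_nat n" "n \<ge> 1" by blast
  hence "1 - s = - of_nat (n - 1)" by (simp add: of_nat_diff)
  thus "1 - s \<in> \<int>\<^sub>\<le>\<^sub>0" by (simp only: minus_of_nat_in_nonpos_Ints)
qed

text \<open>\<open>Gamma\<close> takes the default value 0 at its poles, which makes
  \<open>hankel_rhs\<close> vanish at every positive integer. The formula is therefore asserted off
  these points, and at \<open>2, 3, ...\<close> the continuation \<open>F\<close> carries the value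
  that the product has as a limit.\<close>

theorem mainTheorem3:
  fixes g \<Delta> \<tau> r \<rho> :: real and Om :: "complex \<Rightarrow> complex"
  assumes "g > 0" and "\<Delta> > 0"
    and "0 < r" and "r < pi"
    and "Om holomorphic_on ({t. Re t > 0} \<union> ball 0 r)"
    and "\<forall>t::real. t > 0 \<longrightarrow> Om (of_real t) = of_real ((1 - exp (- t)) * Z_Rabi g \<Delta> t)"
    and "\<tau> > g^2 + \<Delta>"
    and "0 < \<rho>" and "\<rho> < r"
  shows "(\<forall>s. hankel_in Om \<tau> s integrable_on {\<rho>..} \<and> hankel_out Om \<tau> s integrable_on {\<rho>..}
              \<and> (\<lambda>w. (- w) powr (s - 1) * hankel_F Om \<tau> w) contour_integrable_on (circlepath 0 \<rho>))
       \<and> (\<forall>s. Re s > 1 \<and> s \<notin> {of_nat n | n. n \<ge> 1} \<longrightarrow> zeta_QRM g \<Delta> s \<tau> = hankel_rhs Om \<tau> \<rho> s)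
       \<and> (\<exists>F. F holomorphic_on (- {1})
              \<and> (\<forall>s. s \<notin> {of_nat n | n. n \<ge> 1} \<longrightarrow> F s = hankel_rhs Om \<tau> \<rho> s)
              \<and> (\<forall>s. Re s > 1 \<longrightarrow> F s = zeta_QRM g \<Delta> s \<tau>)
              \<and> is_pole F 1 \<and> ((\<lambda>s. (s - 1) * F s) \<longlongrightarrow> 2) (at 1) \<and> residue F 1 = 2)"
proof -
  obtain \<mu> :: "nat \<Rightarrow> real" and c where c: "c > 0" "\<forall>j. \<mu> j + \<tau> \<ge> c * (real j + 1)"
    and lim: "((\<lambda>t. t * (\<Sum>j. exp (- t * \<mu> j))) \<longlongrightarrow> 2) (at_right 0)"
    and Z: "\<forall>t>0. (\<lambda>j. exp (- t * \<mu> j)) sums Z_Rabi g \<Delta> t"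
    and zeta: "\<forall>s. summable (\<lambda>j. norm (complex_of_real (\<mu> j + \<tau>) powr (- s))) \<longrightarrow>
       zeta_QRM g \<Delta> s \<tau> = (\<Sum>j. complex_of_real (\<mu> j + \<tau>) powr (- s))"
    by (rule rabi_spectrum_sequence[OF assms(1,2,7)])
  interpret linear_growth "\<lambda>j. \<mu> j + \<tau>" c by unfold_locales (use c in auto)
  have heat: "heat x = exp (- \<tau> * x) * Z_Rabi g \<Delta> x" if "x > 0" for x
  proof -
    have "(\<lambda>j. exp (- \<tau> * x) * exp (- x * \<mu> j)) sums (exp (- \<tau> * x) * Z_Rabi g \<Delta> x)"
      using Z that by (intro sums_mult) auto
    also have "(\<lambda>j. exp (- \<tau> * x) * exp (- x * \<mu> j)) = (\<lambda>j. exp (- (\<mu> j + \<tau>) * x))"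
      by (simp add: algebra_simps flip: exp_add)
    finally show ?thesis unfolding heat_def by (rule sums_unique[symmetric])
  qed
  have F_real: "hankel_F Om \<tau> (of_real x) = of_real (heat x)" if x: "x > 0" for x
  proof -
    have 1: "exp (- of_real \<tau> * of_real x) = complex_of_real (exp (- \<tau> * x))"
      by (metis exp_of_real of_real_minus of_real_mult)
    have 2: "1 - exp (- of_real x) = complex_of_real (1 - exp (- x))"
      by (metis exp_of_real of_real_1 of_real_diff of_real_minus)
    have "(1 - exp (- x)) * Z_Rabi g \<Delta> x * exp (- \<tau> * x) / (1 - exp (- x)) = heat x"
      using x by (simp add: heat[OF x])
    thus ?thesis unfolding hankel_F_def 1 2 assms(6)[rule_format, OF x]
      by (simp only: flip: of_real_mult of_real_divide)
  qed
  \<comment> \<open>The last factor is continued by its limit 1 at 0, so that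
    \<open>K 0 = Om 0\<close>.\<close>
  define K where "K w = Om w * exp (- of_real \<tau> * w) * (if w = 0 then 1 else w / (1 - exp (- w)))" for w
  interpret hankel_contour Om \<tau> \<rho> r c "1 / (1 - exp (- c * \<rho>))" K
  proof
    show "K holomorphic_on ball 0 r" unfolding K_def
      by (intro holomorphic_on_mult holomorphic_on_subset[OF assms(5)] holomorphic_on_subset[OF todd_holomorphic] holomorphic_intros)
        (use assms(4) in auto)
    show "hankel_F Om \<tau> w = K w / w" if "w \<in> ball 0 r" "w \<noteq> 0" for w
      using that by (simp add: hankel_F_def K_def)
    have "continuous_on {\<rho>..} (\<lambda>x. Om (of_real x))"
      by (rule continuous_on_compose2[OF holomorphic_on_imp_continuous_on[OF assms(5)]])
        (use assms(8) in \<open>auto intro!: continuous_intros\<close>)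
    moreover have "1 - exp (- complex_of_real x) \<noteq> 0" if "x \<in> {\<rho>..}" for x
      using that assms(8) by (intro one_minus_exp_nonzero) auto
    ultimately show "continuous_on {\<rho>..} (\<lambda>x. hankel_F Om \<tau> (of_real x))"
      unfolding hankel_F_def by (intro continuous_intros) auto
    show "norm (hankel_F Om \<tau> (of_real x)) \<le> 1 / (1 - exp (- c * \<rho>)) * exp (- c * x)" if "\<rho> \<le> x" for x
    proof -
      have x: "x > 0" using that assms(8) by simp
      have "norm (hankel_F Om \<tau> (of_real x)) = heat x"
        using heat_geometric(2)[OF x] by (simp add: F_real[OF x])
      also have "\<dots> \<le> exp (- c * x) / (1 - exp (- c * x))" by (rule heat_geometric(3)[OF x])
      also have "\<dots> \<le> exp (- c * x) / (1 - exp (- c * \<rho>))"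
        using that c(1) assms(8) by (intro divide_left_mono) auto
      finally show ?thesis by simp
    qed
  qed (use assms c in auto)

  \<comment> \<open>The relation to the trace holds only for \<open>t > 0\<close>; continuity of the
    extension carries the limit of \<open>(1 - exp (- t)) * Z_Rabi g \<Delta> t\<close> over to
    0.\<close>
  have Om_0: "Om 0 = 2"
  proof -
    have "continuous_on (ball 0 r) Om"
      by (intro holomorphic_on_imp_continuous_on holomorphic_on_subset[OF assms(5)]) auto
    hence "isCont Om 0" using assms(3) by (simp add: continuous_on_eq_continuous_at)
    moreover have "(complex_of_real \<longlongrightarrow> 0) (at_right 0)"
      using tendsto_of_real[OF tendsto_ident_at[of 0 "{0<..}"], where 'a = complex] by simp
    ultimately have "((\<lambda>t. Om (complex_of_real t)) \<longlongrightarrow> Om 0) (at_right 0)"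
      by (rule isCont_tendsto_compose)
    moreover have "((\<lambda>t. Om (complex_of_real t)) \<longlongrightarrow> of_real (1 * 2)) (at_right 0)"
    proof (rule Lim_transform_eventually)
      have "((\<lambda>t::real. (1 - exp (- t)) / t) \<longlongrightarrow> 1) (at_right 0)" by real_asymp
      thus "((\<lambda>t. complex_of_real ((1 - exp (- t)) / t * (t * (\<Sum>j. exp (- t * \<mu> j))))) \<longlongrightarrow> of_real (1 * 2)) (at_right 0)"
        by (intro tendsto_of_real tendsto_mult lim)
      show "eventually (\<lambda>t. complex_of_real ((1 - exp (- t)) / t * (t * (\<Sum>j. exp (- t * \<mu> j)))) = Om (complex_of_real t)) (at_right 0)"
        using eventually_at_right_less[of 0]
      proof eventually_elim
        case (elim t)
        have "(1 - exp (- t)) / t * (t * (\<Sum>j. exp (- t * \<mu> j))) = (1 - exp (- t)) * Z_Rabi g \<Delta> t"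
          using Z elim by (simp add: sums_iff)
        thus ?case using assms(6) elim by simp
      qed
    qed
    ultimately show ?thesis using tendsto_unique[of "at_right (0::real)"] by force
  qed
  have K_0: "K 0 = 2" using Om_0 by (simp add: K_def)

  define P :: "complex set" where "P = {of_nat n | n. n \<ge> 1}"
  have P_eq: "P = of_nat ` {1..}" by (auto simp: P_def)
  have P_closed: "closed P" unfolding P_eq by (rule closed_of_nat_image)

  have zeta_dirichlet: "zeta_QRM g \<Delta> s \<tau> = dirichlet s" if "Re s > 1" for s
    unfolding dirichlet_def using zeta summable_dirichlet[OF that] by blast
  have zeta_rhs: "dirichlet s = hankel_rhs Om \<tau> \<rho> s" if s: "Re s > 1" "s \<notin> P" for s
  proof -
    have "((\<lambda>x. of_real x powr (s - 1) * hankel_F Om \<tau> (of_real x)) has_integral (Gamma s * dirichlet s)) {0<..}"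
      by (rule has_integral_eq[OF _ mellin_heat[OF s(1)]]) (auto simp: F_real)
    hence I: "hankel_integral Om \<tau> \<rho> s = - (2 * \<i> * sin (of_real pi * s)) * (Gamma s * dirichlet s)"
      using hankel_integral_collapse[OF s(1)] by (simp add: branch_jump_eq_sin)
    have "sin (of_real pi * s) \<noteq> 0"
    proof
      assume "sin (of_real pi * s) = 0"
      then obtain n :: int where "of_real pi * s = of_real (n * pi)" by (auto simp: sin_eq_0)
      hence n: "s = of_int n" by (simp add: mult.commute)
      hence "n \<ge> 1" using s(1) by simp
      hence "s = of_nat (nat n)" "nat n \<ge> 1" using n by auto
      thus False using s(2) unfolding P_def by blast
    qed
    hence "Gamma s * Gamma (1 - s) * sin (of_real pi * s) = of_real pi"
      by (simp add: Gamma_reflection_complex)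
    hence "hankel_rhs Om \<tau> \<rho> s = of_real pi * dirichlet s / of_real pi"
      unfolding hankel_rhs_def I by (simp add: field_simps)
    thus ?thesis by simp
  qed

  \<comment> \<open>The two pieces agree on their overlap. The series covers the points
    \<open>2, 3, ...\<close> at which the Gamma factor fails, the contour formula everything outside
    \<open>P\<close>; closedness of \<open>P\<close> makes the second domain open.\<close>
  define F where "F s = (if s \<in> {s. Re s > 1} then dirichlet s else hankel_rhs Om \<tau> \<rho> s)" for s
  have F_rhs: "F s = hankel_rhs Om \<tau> \<rho> s" if "s \<notin> P" for s
    using zeta_rhs[of s] that by (auto simp: F_def)
  have rhs_hol: "hankel_rhs Om \<tau> \<rho> holomorphic_on (- P)"
    unfolding hankel_rhs_def [abs_def]
    by (intro holomorphic_intros holomorphic_on_subset[OF holomorphic_hankel_integral])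
      (use Gamma_one_minus_singular_iff in \<open>auto simp: P_def\<close>)
  have "F holomorphic_on ({s. Re s > 1} \<union> - P)"
    unfolding F_def
    by (rule holomorphic_on_If_Un[OF holomorphic_dirichlet rhs_hol])
      (use zeta_rhs P_closed in \<open>auto simp: open_halfspace_Re_gt\<close>)
  moreover have "- {1} \<subseteq> {s. Re s > 1} \<union> - P"
  proof
    fix s :: complex assume "s \<in> - {1}"
    show "s \<in> {s. Re s > 1} \<union> - P"
    proof (cases "s \<in> P")
      case True
      then obtain n where n: "s = of_nat n" "n \<ge> 1" by (auto simp: P_def)
      have "n \<noteq> 1" using \<open>s \<in> - {1}\<close> n by auto
      thus ?thesis using n by simp
    qed simp
  qed
  ultimately have F_hol: "F holomorphic_on (- {1})" by (rule holomorphic_on_subset)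

  have F_lim: "((\<lambda>s. (s - 1) * F s) \<longlongrightarrow> 2) (at 1)"
  proof (rule Lim_transform_eventually)
    \<comment> \<open>\<open>Gamma (2 - s) = (1 - s) * Gamma (1 - s)\<close> absorbs both the factor
      \<open>s - 1\<close> and the minus sign of \<open>hankel_rhs\<close>, which leaves an
      expression continuous at 1.\<close>
    have "isCont (hankel_integral Om \<tau> \<rho>) 1"
      using holomorphic_on_imp_continuous_on[OF holomorphic_hankel_integral] by (simp add: continuous_on_eq_continuous_at)
    hence "((\<lambda>s. Gamma (2 - s) * hankel_integral Om \<tau> \<rho> s / (2 * of_real pi * \<i>)) \<longlongrightarrow>
        Gamma (2 - 1) * hankel_integral Om \<tau> \<rho> 1 / (2 * of_real pi * \<i>)) (at 1)"
      unfolding isCont_def by (intro tendsto_intros) auto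
    thus "((\<lambda>s. Gamma (2 - s) * hankel_integral Om \<tau> \<rho> s / (2 * of_real pi * \<i>)) \<longlongrightarrow> 2) (at 1)"
      by (simp add: hankel_integral_1 K_0)
    have "eventually (\<lambda>s. s \<in> ball 1 1 - {1}) (at (1 :: complex))"
      by (intro eventually_at_in_open) auto
    thus "eventually (\<lambda>s. Gamma (2 - s) * hankel_integral Om \<tau> \<rho> s / (2 * of_real pi * \<i>) = (s - 1) * F s) (at 1)"
    proof eventually_elim
      case (elim s)
      have "s \<notin> P"
      proof
        assume "s \<in> P"
        then obtain n where n: "s = of_nat n" "n \<ge> 1" by (auto simp: P_def)
        have "norm (of_nat n - of_nat 1 :: complex) < 1" using elim n by (simp add: dist_norm norm_minus_commute)
        hence "dist (of_nat n :: complex) (of_nat 1) < 1" by (simp add: dist_norm)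
        hence "n = 1" unfolding dist_of_nat by linarith
        thus False using elim n by simp
      qed
      hence "1 - s \<notin> \<int>\<^sub>\<le>\<^sub>0" using Gamma_one_minus_singular_iff by (auto simp: P_def)
      hence "Gamma (1 - s + 1) = (1 - s) * Gamma (1 - s)"
        by (rule Gamma_plus1)
      hence G: "Gamma (2 - s) = (1 - s) * Gamma (1 - s)" by (simp add: algebra_simps)
      show ?case unfolding F_rhs[OF \<open>s \<notin> P\<close>] hankel_rhs_def G by (simp add: field_simps)
    qed
  qed
  have F_pole: "is_pole F 1"
  proof -
    have "filterlim (\<lambda>s. s - 1) (at 0) (at (1 :: complex))"
      by (auto simp: filterlim_at eventually_at_filter intro!: tendsto_eq_intros)
    from filterlim_divide_at_infinity[OF F_lim this]
    have "filterlim (\<lambda>s. (s - 1) * F s / (s - 1)) at_infinity (at 1)" by simp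
    thus ?thesis unfolding is_pole_def
      by (rule filterlim_cong[THEN iffD1, rotated -1]) (auto simp: eventually_at_filter)
  qed
  have F_res: "residue F 1 = 2"
    by (rule residue_simple'[of UNIV])
      (use F_hol F_lim in \<open>auto simp: Compl_eq_Diff_UNIV mult.commute\<close>)
  have "\<exists>F. F holomorphic_on (- {1})
      \<and> (\<forall>s. s \<notin> {of_nat n | n. n \<ge> 1} \<longrightarrow> F s = hankel_rhs Om \<tau> \<rho> s)
      \<and> (\<forall>s. Re s > 1 \<longrightarrow> F s = zeta_QRM g \<Delta> s \<tau>)
      \<and> is_pole F 1 \<and> ((\<lambda>s. (s - 1) * F s) \<longlongrightarrow> 2) (at 1) \<and> residue F 1 = 2"
    using F_hol F_rhs F_pole F_lim F_res zeta_dirichlet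
    by (intro exI[of _ F]) (auto simp: P_def F_def)
  moreover have "hankel_in Om \<tau> s integrable_on {\<rho>..} \<and> hankel_out Om \<tau> s integrable_on {\<rho>..}
      \<and> (\<lambda>w. (- w) powr (s - 1) * hankel_F Om \<tau> w) contour_integrable_on (circlepath 0 \<rho>)" for s
    using hankel_rays[of s] has_contour_integral_circle[of s]
    by (blast intro: has_integral_integrable has_contour_integral_integrable)
  moreover have "\<forall>s. Re s > 1 \<and> s \<notin> {of_nat n | n. n \<ge> 1} \<longrightarrow> zeta_QRM g \<Delta> s \<tau> = hankel_rhs Om \<tau> \<rho> s"
    using zeta_dirichlet zeta_rhs unfolding P_def by simp
  ultimately show ?thesis by blast
qed

end
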